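(* Let $\mathcal{L}$ be a first-order language extending the language of arithmetic and containing symbols sufficient to encode natural and rational numbers, finite channel encodings $e\in\{0,1\}^\ast$, rational thresholds $q$, and the predicate $\mathrm{Cap}(e,q)$. There is no consistent recursively axiomatizable theory $\mathsf{T}$ over $\mathcal{L}$ that is sound with respect to the intended semantics, interprets Robinson arithmetic $Q$, has provability predicate $\mathrm{Prov}_{\mathsf{T}}$ satisfying the Hilbert--Bernays derivability conditions, and proves the uniform reflection principle $$\forall e,q\;\big(\mathrm{Prov}_{\mathsf{T}}(\ulcorner\mathrm{Cap}(e,q)\urcorner)\rightarrow\mathrm{Cap}(e,q)\big).$$
   Context: $\mathrm{Cap}(e,q)$ denotes the closed $\mathcal{L}$-sentence obtained by substituting the numerals/encodings of $e$ and $q$ into a fixed formula schema; its intended semantics is that $\mathrm{Cap}(e,q)$ is true iff $C_{\mathrm{fb}}(W_e,\pi_{1,e})\ge q$. $\mathrm{Prov}_{\mathsf{T}}(x)$ is the standard arithmetized predicate "$x$ is the Gödel code of a sentence provable in $\mathsf{T}$". "Recursively axiomatizable" means the set of Gödel codes of axioms is recursively enumerable. "Sound" means every theorem of $\mathsf{T}$ is true under the intended semantics. Channels: $e$ encodes (under a fixed effective encoding) a finite-state channel with alphabets $\mathcal{X}=\mathcal{Y}=\{0,1\}$, a finite state set $\mathcal{S}$, a rational initial distribution $\pi_{1,e}$ on $\mathcal{S}$, and a rational time-homogeneous kernel $W_e(y,s'\mid x,s)$ which is unifilar: there is $f:\mathcal{S}\times\mathcal{X}\times\mathcal{Y}\to\mathcal{S}$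 such that $W_e(y,s'\mid x,s)>0$ implies $s'=f(s,x,y)$. Feedback capacity. For $n\ge1$, a causal input policy is $p(x^n\Vert y^{n-1})=\prod_{t=1}^n p(x_t\mid x^{t-1},y^{t-1})$. It induces the joint law $P_p(x^n,y^n,s^{n+1})=\pi_{1,e}(s_1)\prod_{t=1}^n p(x_t\mid x^{t-1},y^{t-1})\,W_e(y_t,s_{t+1}\mid x_t,s_t)$. Directed information is $I(X^n\to Y^n)=\sum_{t=1}^n I(X^t;Y_t\mid Y^{t-1})$ (logarithms base 2). Set $V_n(W_e,\pi_{1,e})=\sup_{p(x^n\Vert y^{n-1})} I(X^n\to Y^n)$ and $C_{\mathrm{fb}}(W_e,\pi_{1,e})=\limsup_{n\to\infty}\frac1n V_n(W_e,\pi_{1,e})$. *)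

theory Defs
  imports "HOL-Probability.Probability" "HOL-Library.Nat_Bijection"
begin

section \<open>First-order languages extending the language of arithmetic\<close>

text \<open>
  Terms and formulas in de Bruijn notation. The symbols of arithmetic are built in; \<open>Fn\<close> and \<open>Rel\<close>
  supply the further symbols, a symbol being a name together with an arity.
\<close>

datatype tm =
    Var nat
  | Zero
  | Succ tm
  | Plus tm tm
  | Times tm tm
  | Fn nat "tm list"

datatype fm =
    Fls
  | Eq tm tm
  | Rel nat "tm list"
  | Imp fm fm
  | All fm

abbreviation Neg :: "fm \<Rightarrow> fm" where "Neg A \<equiv> Imp A Fls"
abbreviation And :: "fm \<Rightarrow> fm \<Rightarrow> fm" where "And A B \<equiv> Neg (Imp A (Neg B))"
abbreviation Iff :: "fm \<Rightarrow> fm \<Rightarrow> fm" where "Iff A B \<equiv> And (Imp A B) (Imp B A)"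
abbreviation Ex :: "fm \<Rightarrow> fm" where "Ex A \<equiv> Neg (All (Neg A))"

record lang =
  funs :: "(nat \<times> nat) set"
  rels :: "(nat \<times> nat) set"

fun wf_tm :: "lang \<Rightarrow> tm \<Rightarrow> bool" where
  "wf_tm L (Var n) = True"
| "wf_tm L Zero = True"
| "wf_tm L (Succ t) = wf_tm L t"
| "wf_tm L (Plus s t) = (wf_tm L s \<and> wf_tm L t)"
| "wf_tm L (Times s t) = (wf_tm L s \<and> wf_tm L t)"
| "wf_tm L (Fn f ts) = ((f, length ts) \<in> funs L \<and> (\<forall>t\<in>set ts. wf_tm L t))"

fun wf_fm :: "lang \<Rightarrow> fm \<Rightarrow> bool" where
  "wf_fm L Fls = True"
| "wf_fm L (Eq s t) = (wf_tm L s \<and> wf_tm L t)"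
| "wf_fm L (Rel r ts) = ((r, length ts) \<in> rels L \<and> (\<forall>t\<in>set ts. wf_tm L t))"
| "wf_fm L (Imp A B) = (wf_fm L A \<and> wf_fm L B)"
| "wf_fm L (All A) = wf_fm L A"

fun fv_tm :: "tm \<Rightarrow> nat set" where
  "fv_tm (Var n) = {n}"
| "fv_tm Zero = {}"
| "fv_tm (Succ t) = fv_tm t"
| "fv_tm (Plus s t) = fv_tm s \<union> fv_tm t"
| "fv_tm (Times s t) = fv_tm s \<union> fv_tm t"
| "fv_tm (Fn f ts) = (\<Union>t\<in>set ts. fv_tm t)"

fun fv :: "fm \<Rightarrow> nat set" where
  "fv Fls = {}"
| "fv (Eq s t) = fv_tm s \<union> fv_tm t"
| "fv (Rel r ts) = (\<Union>t\<in>set ts. fv_tm t)"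
| "fv (Imp A B) = fv A \<union> fv B"
| "fv (All A) = {n. Suc n \<in> fv A}"

text \<open>An \<open>L\<close>-formula whose free variables are among \<open>Var 0, \<dots>, Var (k - 1)\<close>.\<close>

definition formula :: "lang \<Rightarrow> nat \<Rightarrow> fm \<Rightarrow> bool" where
  "formula L k A \<longleftrightarrow> wf_fm L A \<and> fv A \<subseteq> {..<k}"

abbreviation sentence :: "lang \<Rightarrow> fm \<Rightarrow> bool" where
  "sentence L \<equiv> formula L 0"

fun subst_tm :: "(nat \<Rightarrow> tm) \<Rightarrow> tm \<Rightarrow> tm" where
  "subst_tm \<sigma> (Var n) = \<sigma> n"
| "subst_tm \<sigma> Zero = Zero"
| "subst_tm \<sigma> (Succ t) = Succ (subst_tm \<sigma> t)"
| "subst_tm \<sigma> (Plus s t) = Plus (subst_tm \<sigma> s) (subst_tm \<sigma> t)"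
| "subst_tm \<sigma> (Times s t) = Times (subst_tm \<sigma> s) (subst_tm \<sigma> t)"
| "subst_tm \<sigma> (Fn f ts) = Fn f (map (subst_tm \<sigma>) ts)"

definition under_binder :: "(nat \<Rightarrow> tm) \<Rightarrow> nat \<Rightarrow> tm" where
  "under_binder \<sigma> = case_nat (Var 0) (\<lambda>n. subst_tm (\<lambda>k. Var (Suc k)) (\<sigma> n))"

fun subst :: "(nat \<Rightarrow> tm) \<Rightarrow> fm \<Rightarrow> fm" where
  "subst \<sigma> Fls = Fls"
| "subst \<sigma> (Eq s t) = Eq (subst_tm \<sigma> s) (subst_tm \<sigma> t)"
| "subst \<sigma> (Rel r ts) = Rel r (map (subst_tm \<sigma>) ts)"
| "subst \<sigma> (Imp A B) = Imp (subst \<sigma> A) (subst \<sigma> B)"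
| "subst \<sigma> (All A) = All (subst (under_binder \<sigma>) A)"

definition lift :: "fm \<Rightarrow> fm" where
  "lift = subst (\<lambda>n. Var (Suc n))"

text \<open>\<open>app A [t\<^sub>0, \<dots>, t\<^sub>k]\<close> substitutes the \<open>t\<^sub>i\<close> for the variables \<open>Var i\<close> and lowers the other ones.\<close>

definition app :: "fm \<Rightarrow> tm list \<Rightarrow> fm" where
  "app A ts = subst (\<lambda>n. if n < length ts then ts ! n else Var (n - length ts)) A"

fun num :: "nat \<Rightarrow> tm" where
  "num 0 = Zero"
| "num (Suc n) = Succ (num n)"


section \<open>Provability\<close>

text \<open>
  A Hilbert calculus for classical first-order logic with equality, over the formulas of \<open>L\<close>.
  The rule \<open>Gen\<close> is sound without proviso because axioms of theories are sentences.
\<close>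

inductive prv :: "lang \<Rightarrow> fm set \<Rightarrow> fm \<Rightarrow> bool" for L :: lang and T :: "fm set" where
  Ax: "A \<in> T \<Longrightarrow> prv L T A"
| ImpK: "wf_fm L A \<Longrightarrow> wf_fm L B \<Longrightarrow> prv L T (Imp A (Imp B A))"
| ImpS: "wf_fm L A \<Longrightarrow> wf_fm L B \<Longrightarrow> wf_fm L C \<Longrightarrow>
    prv L T (Imp (Imp A (Imp B C)) (Imp (Imp A B) (Imp A C)))"
| DNeg: "wf_fm L A \<Longrightarrow> prv L T (Imp (Neg (Neg A)) A)"
| AllE: "wf_fm L A \<Longrightarrow> wf_tm L t \<Longrightarrow> prv L T (Imp (All A) (app A [t]))"
| AllImp: "wf_fm L A \<Longrightarrow> wf_fm L B \<Longrightarrow> prv L T (Imp (All (Imp A B)) (Imp (All A) (All B)))"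
| Vac: "wf_fm L A \<Longrightarrow> prv L T (Imp A (All (lift A)))"
| Refl: "wf_tm L t \<Longrightarrow> prv L T (Eq t t)"
| Leibniz: "wf_fm L A \<Longrightarrow> wf_tm L s \<Longrightarrow> wf_tm L t \<Longrightarrow>
    prv L T (Imp (Eq s t) (Imp (app A [s]) (app A [t])))"
| MP: "prv L T (Imp A B) \<Longrightarrow> prv L T A \<Longrightarrow> prv L T B"
| Gen: "prv L T A \<Longrightarrow> prv L T (All A)"

definition theory_over :: "lang \<Rightarrow> fm set \<Rightarrow> bool" where
  "theory_over L T \<longleftrightarrow> (\<forall>A\<in>T. sentence L A)"

definition consistent :: "lang \<Rightarrow> fm set \<Rightarrow> bool" where
  "consistent L T \<longleftrightarrow> \<not> prv L T Fls"


section \<open>Intended semantics: expansions of the standard model of arithmetic\<close>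

record expansion =
  fun_of :: "nat \<Rightarrow> nat list \<Rightarrow> nat"
  rel_of :: "nat \<Rightarrow> nat list \<Rightarrow> bool"

fun val :: "expansion \<Rightarrow> (nat \<Rightarrow> nat) \<Rightarrow> tm \<Rightarrow> nat" where
  "val M \<rho> (Var n) = \<rho> n"
| "val M \<rho> Zero = 0"
| "val M \<rho> (Succ t) = Suc (val M \<rho> t)"
| "val M \<rho> (Plus s t) = val M \<rho> s + val M \<rho> t"
| "val M \<rho> (Times s t) = val M \<rho> s * val M \<rho> t"
| "val M \<rho> (Fn f ts) = fun_of M f (map (val M \<rho>) ts)"

fun sat :: "expansion \<Rightarrow> (nat \<Rightarrow> nat) \<Rightarrow> fm \<Rightarrow> bool" where
  "sat M \<rho> Fls = False"
| "sat M \<rho> (Eq s t) = (val M \<rho> s = val M \<rho> t)"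
| "sat M \<rho> (Rel r ts) = rel_of M r (map (val M \<rho>) ts)"
| "sat M \<rho> (Imp A B) = (sat M \<rho> A \<longrightarrow> sat M \<rho> B)"
| "sat M \<rho> (All A) = (\<forall>a. sat M (case_nat a \<rho>) A)"

definition true_in :: "expansion \<Rightarrow> fm \<Rightarrow> bool" where
  "true_in M A \<longleftrightarrow> (\<forall>\<rho>. sat M \<rho> A)"

definition sound :: "lang \<Rightarrow> expansion \<Rightarrow> fm set \<Rightarrow> bool" where
  "sound L M T \<longleftrightarrow> (\<forall>A. sentence L A \<and> prv L T A \<longrightarrow> true_in M A)"


section \<open>Goedel codes and recursive axiomatizability\<close>

fun code_tm :: "tm \<Rightarrow> nat" where
  "code_tm (Var n) = list_encode [0, n]"
| "code_tm Zero = list_encode [1]"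
| "code_tm (Succ t) = list_encode [2, code_tm t]"
| "code_tm (Plus s t) = list_encode [3, code_tm s, code_tm t]"
| "code_tm (Times s t) = list_encode [4, code_tm s, code_tm t]"
| "code_tm (Fn f ts) = list_encode (5 # f # map code_tm ts)"

fun code :: "fm \<Rightarrow> nat" where
  "code Fls = list_encode [0]"
| "code (Eq s t) = list_encode [1, code_tm s, code_tm t]"
| "code (Rel r ts) = list_encode (2 # r # map code_tm ts)"
| "code (Imp A B) = list_encode [3, code A, code B]"
| "code (All A) = list_encode [4, code A]"

lemma code_tm_inj: "code_tm s = code_tm t \<Longrightarrow> s = t"
proof (induction s arbitrary: t)
  case (Fn f ts)
  from Fn.prems obtain ts' where t: "t = Fn f ts'" and eq: "map code_tm ts = map code_tm ts'"
    by (cases t) (auto simp: list_encode_eq simp del: list_encode.simps)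
  have "ts = ts'"
  proof (rule nth_equalityI)
    show len: "length ts = length ts'"
      using eq by (rule map_eq_imp_length_eq)
    show "ts ! i = ts' ! i" if "i < length ts" for i
      using Fn.IH[OF nth_mem[OF that], of "ts' ! i"] that len eq by (metis nth_map)
  qed
  then show ?case by (simp add: t)
qed (case_tac t; auto simp: list_encode_eq simp del: list_encode.simps)+

lemma code_inj: "code A = code B \<Longrightarrow> A = B"
proof (induction A arbitrary: B)
  case (Rel r ts)
  have "inj code_tm" by (auto intro: injI code_tm_inj)
  with Rel show ?case
    by (cases B) (auto simp: list_encode_eq inj_map_eq_map simp del: list_encode.simps)
qed (case_tac B; auto simp: list_encode_eq simp del: list_encode.simps dest: code_tm_inj)+

text \<open>Partial recursive functions, by the graph of the function computed by a definition scheme.\<close>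

datatype recf =
    RZero
  | RSucc
  | RProj nat
  | RComp recf "recf list"
  | RPrim recf recf
  | RMin recf

inductive computes :: "recf \<Rightarrow> nat list \<Rightarrow> nat \<Rightarrow> bool" where
  "computes RZero xs 0"
| "computes RSucc [x] (Suc x)"
| "i < length xs \<Longrightarrow> computes (RProj i) xs (xs ! i)"
| "length gs = length ys \<Longrightarrow> (\<And>i. i < length gs \<Longrightarrow> computes (gs ! i) xs (ys ! i)) \<Longrightarrow>
    computes f ys v \<Longrightarrow> computes (RComp f gs) xs v"
| "computes f xs v \<Longrightarrow> computes (RPrim f g) (0 # xs) v"
| "computes (RPrim f g) (n # xs) u \<Longrightarrow> computes g (n # u # xs) v \<Longrightarrow>
    computes (RPrim f g) (Suc n # xs) v"
| "computes f (n # xs) 0 \<Longrightarrow> (\<And>m. m < n \<Longrightarrow> \<exists>v. v \<noteq> 0 \<and> computes f (m # xs) v) \<Longrightarrow>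
    computes (RMin f) xs n"

definition rec_enumerable :: "nat set \<Rightarrow> bool" where
  "rec_enumerable A \<longleftrightarrow> (\<exists>f. \<forall>n. n \<in> A \<longleftrightarrow> (\<exists>v. computes f [n] v))"

definition rec_axiomatized :: "fm set \<Rightarrow> bool" where
  "rec_axiomatized T \<longleftrightarrow> rec_enumerable (code ` T)"


section \<open>Interpretations of Robinson arithmetic\<close>

definition robinson_Q :: "fm set" where
  "robinson_Q =
    {All (All (Imp (Eq (Succ (Var 1)) (Succ (Var 0))) (Eq (Var 1) (Var 0)))),
     All (Neg (Eq (Succ (Var 0)) Zero)),
     All (Imp (Neg (Eq (Var 0) Zero)) (Ex (Eq (Var 1) (Succ (Var 0))))),
     All (Eq (Plus (Var 0) Zero) (Var 0)),
     All (All (Eq (Plus (Var 1) (Succ (Var 0))) (Succ (Plus (Var 1) (Var 0))))),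
     All (Eq (Times (Var 0) Zero) Zero),
     All (All (Eq (Times (Var 1) (Succ (Var 0))) (Plus (Times (Var 1) (Var 0)) (Var 1))))}"

text \<open>
  A relative interpretation consists of a formula \<open>dom\<close> for the domain and formulas for the graphs of
  the arithmetical operations, the last variable of which stands for the value.
\<close>

record interp =
  dom :: fm
  zero_gr :: fm
  succ_gr :: fm
  plus_gr :: fm
  times_gr :: fm

abbreviation AllD :: "interp \<Rightarrow> fm \<Rightarrow> fm" where
  "AllD I A \<equiv> All (Imp (app (dom I) [Var 0]) A)"

abbreviation ExD :: "interp \<Rightarrow> fm \<Rightarrow> fm" where
  "ExD I A \<equiv> Ex (And (app (dom I) [Var 0]) A)"

text \<open>
  \<open>value_is I t\<close> says that the interpreted value of \<open>t\<close> is \<open>Var 0\<close>; the variable \<open>Var n\<close> of \<open>t\<close> has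
  become \<open>Var (Suc n)\<close>. Only the terms and formulas of arithmetic are relevant here.
\<close>

fun value_is :: "interp \<Rightarrow> tm \<Rightarrow> fm" where
  "value_is I (Var n) = Eq (Var 0) (Var (Suc n))"
| "value_is I Zero = app (zero_gr I) [Var 0]"
| "value_is I (Succ t) =
    ExD I (And (subst (case_nat (Var 0) (\<lambda>n. Var (n + 2))) (value_is I t))
               (app (succ_gr I) [Var 0, Var 1]))"
| "value_is I (Plus s t) =
    ExD I (ExD I (And (subst (case_nat (Var 1) (\<lambda>n. Var (n + 3))) (value_is I s))
                 (And (subst (case_nat (Var 0) (\<lambda>n. Var (n + 3))) (value_is I t))
                      (app (plus_gr I) [Var 1, Var 0, Var 2]))))"
| "value_is I (Times s t) =
    ExD I (ExD I (And (subst (case_nat (Var 1) (\<lambda>n. Var (n + 3))) (value_is I s))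
                 (And (subst (case_nat (Var 0) (\<lambda>n. Var (n + 3))) (value_is I t))
                      (app (times_gr I) [Var 1, Var 0, Var 2]))))"
| "value_is I (Fn f ts) = Fls"

fun translate :: "interp \<Rightarrow> fm \<Rightarrow> fm" where
  "translate I Fls = Fls"
| "translate I (Eq s t) = ExD I (And (value_is I s) (value_is I t))"
| "translate I (Rel r ts) = Fls"
| "translate I (Imp A B) = Imp (translate I A) (translate I B)"
| "translate I (All A) = AllD I (translate I A)"

definition interpretation_of_Q :: "lang \<Rightarrow> fm set \<Rightarrow> interp \<Rightarrow> bool" where
  "interpretation_of_Q L T I \<longleftrightarrow>
     formula L 1 (dom I) \<and> formula L 1 (zero_gr I) \<and> formula L 2 (succ_gr I) \<and>
     formula L 3 (plus_gr I) \<and> formula L 3 (times_gr I) \<and>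
     \<comment> \<open>the graphs are those of operations on the domain\<close>
     prv L T (ExD I (AllD I (Iff (app (zero_gr I) [Var 0]) (Eq (Var 0) (Var 1))))) \<and>
     prv L T (AllD I (ExD I (AllD I
       (Iff (app (succ_gr I) [Var 2, Var 0]) (Eq (Var 0) (Var 1)))))) \<and>
     prv L T (AllD I (AllD I (ExD I (AllD I
       (Iff (app (plus_gr I) [Var 3, Var 2, Var 0]) (Eq (Var 0) (Var 1))))))) \<and>
     prv L T (AllD I (AllD I (ExD I (AllD I
       (Iff (app (times_gr I) [Var 3, Var 2, Var 0]) (Eq (Var 0) (Var 1))))))) \<and>
     (\<forall>A\<in>robinson_Q. prv L T (translate I A))"

text \<open>
  The language already contains the numerals, which carry all codes. So the numbers of the
  interpretation have to be the ones that the numerals denote; the operations may be interpreted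
  in any way otherwise.
\<close>

definition numerals_agree :: "lang \<Rightarrow> fm set \<Rightarrow> interp \<Rightarrow> bool" where
  "numerals_agree L T I \<longleftrightarrow>
     prv L T (app (zero_gr I) [num 0]) \<and>
     (\<forall>n. prv L T (app (dom I) [num n])) \<and>
     (\<forall>n. prv L T (app (succ_gr I) [num n, num (Suc n)]))"

definition interprets_Q :: "lang \<Rightarrow> fm set \<Rightarrow> bool" where
  "interprets_Q L T \<longleftrightarrow> (\<exists>I. interpretation_of_Q L T I \<and> numerals_agree L T I)"


section \<open>Provability predicates and uniform reflection\<close>

definition quote :: "fm \<Rightarrow> tm" where
  "quote A = num (code A)"

definition provability_predicate :: "lang \<Rightarrow> expansion \<Rightarrow> fm set \<Rightarrow> fm \<Rightarrow> bool" where
  "provability_predicate L M T Prov \<longleftrightarrow>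
     formula L 1 Prov \<and>
     (\<forall>n. true_in M (app Prov [num n]) \<longleftrightarrow> (\<exists>A. sentence L A \<and> prv L T A \<and> code A = n))"

definition derivability_conditions :: "lang \<Rightarrow> fm set \<Rightarrow> fm \<Rightarrow> bool" where
  "derivability_conditions L T Prov \<longleftrightarrow>
     (\<forall>A. sentence L A \<longrightarrow> prv L T A \<longrightarrow> prv L T (app Prov [quote A])) \<and>
     (\<forall>A B. sentence L A \<longrightarrow> sentence L B \<longrightarrow>
        prv L T (Imp (app Prov [quote (Imp A B)])
                     (Imp (app Prov [quote A]) (app Prov [quote B])))) \<and>
     (\<forall>A. sentence L A \<longrightarrow>
        prv L T (Imp (app Prov [quote A]) (app Prov [quote (app Prov [quote A])])))"

text \<open>
  In uniform reflection the variables \<open>e, q\<close> are quantified inside the theory, so the corner quotes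
  denote the function taking \<open>e, q\<close> to the code of the instance of \<open>A\<close> at the numerals of \<open>e, q\<close>.
  The formula \<open>Sub\<close>, with the value as third argument, represents this function in the theory.
\<close>

definition represents_instances :: "lang \<Rightarrow> fm set \<Rightarrow> fm \<Rightarrow> fm \<Rightarrow> bool" where
  "represents_instances L T A Sub \<longleftrightarrow>
     formula L 3 Sub \<and>
     (\<forall>m n. prv L T (All (Iff (app Sub [num m, num n, Var 0])
                              (Eq (Var 0) (quote (app A [num m, num n]))))))"

definition uniform_reflection :: "fm \<Rightarrow> fm \<Rightarrow> fm \<Rightarrow> fm" where
  "uniform_reflection Prov Sub A =
     All (All (Imp (Ex (And (app Sub [Var 2, Var 1, Var 0]) (app Prov [Var 0])))
                   (app A [Var 1, Var 0])))"


section \<open>Finite-state channels and their encoding\<close>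

text \<open>
  Both alphabets are \<open>bool\<close>, the state set is \<open>{..<states C}\<close>, and \<open>kernel C x s (y, s')\<close> is
  $W(y, s' \mid x, s)$.
\<close>

record fsc =
  states :: nat
  init :: "nat \<Rightarrow> rat"
  kernel :: "bool \<Rightarrow> nat \<Rightarrow> bool \<times> nat \<Rightarrow> rat"

definition unifilar :: "fsc \<Rightarrow> bool" where
  "unifilar C \<longleftrightarrow>
     (\<exists>f. (\<forall>s<states C. \<forall>x y. f s x y < states C) \<and>
          (\<forall>s<states C. \<forall>s'<states C. \<forall>x y. kernel C x s (y, s') > 0 \<longrightarrow> s' = f s x y))"

definition unifilar_fsc :: "fsc \<Rightarrow> bool" where
  "unifilar_fsc C \<longleftrightarrow>
     states C > 0 \<and>
     (\<forall>s. init C s \<ge> 0) \<and> (\<forall>s\<ge>states C. init C s = 0) \<and> (\<Sum>s<states C. init C s) = 1 \<and>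
     (\<forall>x s z. kernel C x s z \<ge> 0) \<and>
     (\<forall>x s y s'. s \<ge> states C \<or> s' \<ge> states C \<longrightarrow> kernel C x s (y, s') = 0) \<and>
     (\<forall>x. \<forall>s<states C. (\<Sum>z\<in>UNIV \<times> {..<states C}. kernel C x s z) = 1) \<and>
     unifilar C"

text \<open>Strings are numbered by bijective binary notation, least significant digit first.\<close>

fun string_code :: "bool list \<Rightarrow> nat" where
  "string_code [] = 0"
| "string_code (b # bs) = 2 * string_code bs + (if b then 2 else 1)"

lemma bij_string_code: "bij string_code"
proof (rule bijI)
  have "string_code a = string_code b \<Longrightarrow> a = b" for a b
  proof (induction a arbitrary: b)
    case Nil then show ?case by (cases b) (auto split: if_splits)
  next
    case (Cons x a)
    then show ?case by (cases b) (auto split: if_splits, presburger+)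
  qed
  then show "inj string_code" by (auto intro: injI)
  have "\<exists>a. n = string_code a" for n
  proof (induction n rule: less_induct)
    case (less n)
    show ?case
    proof (cases "n = 0")
      case True then show ?thesis by (intro exI[of _ "[]"]) simp
    next
      case False
      then have "(n - 1) div 2 < n" by linarith
      from less.IH[OF this] obtain a where "(n - 1) div 2 = string_code a" ..
      then have "n = string_code (even n # a)" using False by simp presburger
      then show ?thesis ..
    qed
  qed
  then show "surj string_code" by (auto simp: surj_def)
qed

text \<open>
  The description of a channel with \<open>m\<close> states is the list of \<open>m\<close>, the \<open>m\<close> initial probabilities and
  the \<open>4 * m * m\<close> transition probabilities, missing entries being \<open>0\<close>. A string that does not
  describe a unifilar channel is read as an encoding of the channel with one state and constant output.
\<close>

definition entry :: "nat list \<Rightarrow> nat \<Rightarrow> rat" where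
  "entry l i = (if i < length l then nat_to_rat_surj (l ! i) else 0)"

definition described_fsc :: "nat list \<Rightarrow> fsc" where
  "described_fsc l =
     (let m = (if l = [] then 0 else hd l) in
      \<lparr>states = m,
       init = (\<lambda>s. if s < m then entry l (1 + s) else 0),
       kernel = (\<lambda>x s (y, s'). if s < m \<and> s' < m
         then entry l (1 + m + (((2 * s + of_bool x) * 2 + of_bool y) * m + s')) else 0)\<rparr>)"

definition constant_fsc :: fsc where
  "constant_fsc =
     \<lparr>states = 1, init = (\<lambda>s. if s = 0 then 1 else 0),
      kernel = (\<lambda>x s z. if s = 0 \<and> z = (False, 0) then 1 else 0)\<rparr>"

definition channel :: "bool list \<Rightarrow> fsc" where
  "channel e =
     (let C = described_fsc (list_decode (string_code e)) in
      if unifilar_fsc C then C else constant_fsc)"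

lemma unifilar_constant_fsc: "unifilar_fsc constant_fsc"
proof -
  have *: "(UNIV :: bool set) \<times> {..<Suc 0} = {(False, 0), (True, 0)}" by (auto simp: UNIV_bool)
  have "unifilar constant_fsc"
    unfolding unifilar_def by (rule exI[of _ "\<lambda>_ _ _. 0"]) (simp add: constant_fsc_def)
  moreover have "(\<Sum>z\<in>UNIV \<times> {..<states constant_fsc}. kernel constant_fsc x 0 z) = 1" for x
    by (simp add: constant_fsc_def *)
  ultimately show ?thesis
    by (simp add: unifilar_fsc_def) (simp add: constant_fsc_def)
qed

lemma range_channel: "range channel = {C. unifilar_fsc C}"
proof
  show "range channel \<subseteq> {C. unifilar_fsc C}"
    by (auto simp: channel_def Let_def unifilar_constant_fsc)
  show "{C. unifilar_fsc C} \<subseteq> range channel"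
  proof
    fix C assume "C \<in> {C. unifilar_fsc C}"
    then have C: "unifilar_fsc C" by simp
    define m where "m = states C"
    define r where "r q = (SOME n. nat_to_rat_surj n = q)" for q
    have r: "nat_to_rat_surj (r q) = q" for q
      unfolding r_def by (rule someI_ex) (metis surj_nat_to_rat_surj surjD)
    define T where "T i = kernel C (odd (i div m div 2)) (i div m div 4) (odd (i div m), i mod m)" for i
    define l where "l = m # map (\<lambda>i. r (init C i)) [0..<m] @ map (\<lambda>i. r (T i)) [0..<4 * m * m]"
    have l_hd: "l \<noteq> []" "hd l = m" by (simp_all add: l_def)
    have e1: "entry l (1 + s) = init C s" if "s < m" for s
      using that by (simp add: entry_def l_def nth_append r)
    have e2: "entry l (1 + m + (((2 * s + of_bool x) * 2 + of_bool y) * m + s')) = kernel C x s (y, s')"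
      if "s < m" "s' < m" for x s y s'
    proof -
      define j where "j = (2 * s + of_bool x) * 2 + (of_bool y :: nat)"
      define i where "i = j * m + s'"
      have "j < 4 * m" using that by (auto simp: j_def)
      then have "(j + 1) * m \<le> 4 * m * m" by (intro mult_le_mono1) simp
      then have "i < 4 * m * m" using that by (simp add: i_def)
      then have "entry l (1 + m + i) = T i"
        by (simp add: entry_def l_def nth_append r)
      moreover have "i div m = j" "i mod m = s'" using that by (auto simp: i_def)
      moreover have "j div 4 = s" "odd (j div 2) = x" "odd j = y"
        by (cases x; cases y; simp add: j_def)+
      ultimately show ?thesis by (simp add: T_def i_def j_def)
    qed
    have init: "init (described_fsc l) s = init C s" for s
    proof (cases "s < m")
      case True
      with e1[OF this] show ?thesis by (simp add: described_fsc_def Let_def l_hd)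
    next
      case False
      then show ?thesis using C by (simp add: described_fsc_def Let_def l_hd unifilar_fsc_def m_def)
    qed
    have kernel: "kernel (described_fsc l) x s (y, s') = kernel C x s (y, s')" for x s y s'
    proof (cases "s < m \<and> s' < m")
      case True
      then show ?thesis using e2[of s s' x y] by (simp only: described_fsc_def Let_def l_hd) simp
    next
      case False
      moreover have "kernel C x s (y, s') = 0"
        using False C unfolding unifilar_fsc_def m_def by (metis not_less)
      ultimately show ?thesis by (simp only: described_fsc_def Let_def l_hd) auto
    qed
    have "described_fsc l = C"
      by (rule fsc.equality)
        (auto simp: init kernel fun_eq_iff, simp_all add: described_fsc_def Let_def l_hd m_def)
    moreover obtain e where "string_code e = list_encode l"
      using bij_string_code by (metis bij_pointE)
    ultimately have "channel e = C" using C by (simp add: channel_def)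
    then show "C \<in> range channel" by blast
  qed
qed


section \<open>Feedback capacity\<close>

definition init_pmf :: "fsc \<Rightarrow> nat pmf" where
  "init_pmf C = embed_pmf (\<lambda>s. real_of_rat (init C s))"

definition kernel_pmf :: "fsc \<Rightarrow> bool \<Rightarrow> nat \<Rightarrow> (bool \<times> nat) pmf" where
  "kernel_pmf C x s = embed_pmf (\<lambda>z. real_of_rat (kernel C x s z))"

lemma pmf_init_pmf:
  assumes "unifilar_fsc C"
  shows "pmf (init_pmf C) s = real_of_rat (init C s)"
  unfolding init_pmf_def
proof (rule pmf_embed_pmf)
  show "0 \<le> real_of_rat (init C s)" for s using assms by (simp add: unifilar_fsc_def)
  have "(\<integral>\<^sup>+ s. ennreal (real_of_rat (init C s)) \<partial>count_space UNIV) =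
      (\<Sum>s<states C. ennreal (real_of_rat (init C s)))"
    by (rule nn_integral_count_space') (use assms in \<open>auto simp: unifilar_fsc_def not_less\<close>)
  also have "\<dots> = ennreal (real_of_rat (\<Sum>s<states C. init C s))"
    unfolding of_rat_sum by (rule sum_ennreal) (use assms in \<open>simp add: unifilar_fsc_def\<close>)
  finally show "(\<integral>\<^sup>+ s. ennreal (real_of_rat (init C s)) \<partial>count_space UNIV) = 1"
    using assms by (simp add: unifilar_fsc_def)
qed

lemma pmf_kernel_pmf:
  assumes "unifilar_fsc C" and "s < states C"
  shows "pmf (kernel_pmf C x s) z = real_of_rat (kernel C x s z)"
  unfolding kernel_pmf_def
proof (rule pmf_embed_pmf)
  let ?k = "\<lambda>z. ennreal (real_of_rat (kernel C x s z))"
  show "0 \<le> real_of_rat (kernel C x s z)" for z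
    using assms by (cases z) (simp add: unifilar_fsc_def)
  have "(\<integral>\<^sup>+ z. ?k z \<partial>count_space UNIV) = (\<Sum>z\<in>UNIV \<times> {..<states C}. ?k z)"
    by (rule nn_integral_count_space') (use assms in \<open>auto simp: unifilar_fsc_def simp flip: not_le\<close>)
  also have "\<dots> = ennreal (real_of_rat (\<Sum>z\<in>UNIV \<times> {..<states C}. kernel C x s z))"
    unfolding of_rat_sum by (rule sum_ennreal) (use assms in \<open>auto simp: unifilar_fsc_def\<close>)
  finally show "(\<integral>\<^sup>+ z. ?k z \<partial>count_space UNIV) = 1"
    using assms by (simp add: unifilar_fsc_def)
qed

text \<open>
  A policy maps the past inputs and outputs \<open>x\<^sup>t\<^sup>-\<^sup>1, y\<^sup>t\<^sup>-\<^sup>1\<close> to the distribution of \<open>x\<^sub>t\<close>. The joint law of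
  $(x^n, y^n, s^{n+1})$ is given in product form by \<open>pmf_joint_law\<close> below.
\<close>

type_synonym policy = "bool list \<Rightarrow> bool list \<Rightarrow> bool pmf"

primrec joint_law :: "fsc \<Rightarrow> policy \<Rightarrow> nat \<Rightarrow> (bool list \<times> bool list \<times> nat list) pmf" where
  "joint_law C p 0 = map_pmf (\<lambda>s. ([], [], [s])) (init_pmf C)"
| "joint_law C p (Suc n) =
     bind_pmf (joint_law C p n) (\<lambda>(xs, ys, ss).
     bind_pmf (p xs ys) (\<lambda>x.
     map_pmf (\<lambda>(y, s'). (xs @ [x], ys @ [y], ss @ [s'])) (kernel_pmf C x (last ss))))"

lemma pmf_bind_single:
  assumes "\<And>w. w \<noteq> w0 \<Longrightarrow> pmf (f w) z = 0"
  shows "pmf (bind_pmf M f) z = pmf M w0 * pmf (f w0) z"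
proof -
  have "pmf (bind_pmf M f) z = (\<Sum>w\<in>{w0}. pmf (f w) z * pmf M w)"
    unfolding pmf_bind by (rule integral_measure_pmf_real) (use assms in auto)
  then show ?thesis by simp
qed

lemma pmf_joint_law_Suc:
  "pmf (joint_law C p (Suc n)) (xs @ [x], ys @ [y], ss @ [s']) =
   pmf (joint_law C p n) (xs, ys, ss) *
     (pmf (p xs ys) x * pmf (kernel_pmf C x (last ss)) (y, s'))"
proof -
  let ?h = "\<lambda>a b c u (v, w). (a @ [u :: bool], b @ [v :: bool], c @ [w :: nat])"
  let ?g = "\<lambda>a b c. bind_pmf (p a b) (\<lambda>u. map_pmf (?h a b c u) (kernel_pmf C u (last c)))"
  let ?z = "(xs @ [x], ys @ [y], ss @ [s'])"
  have 0: "pmf (map_pmf (?h a b c u) (kernel_pmf C u (last c))) ?z = 0"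
    if "(a, b, c, u) \<noteq> (xs, ys, ss, x)" for a b c u
    using that by (intro pmf_eq_0_set_pmf[THEN iffD2]) auto
  have "pmf (?g a b c) ?z = 0" if "(a, b, c) \<noteq> (xs, ys, ss)" for a b c
    unfolding pmf_bind using that 0 by (auto intro!: integral_eq_zero_AE)
  then have "pmf (joint_law C p (Suc n)) ?z = pmf (joint_law C p n) (xs, ys, ss) * pmf (?g xs ys ss) ?z"
    using pmf_bind_single[of "(xs, ys, ss)" "\<lambda>(a, b, c). ?g a b c" ?z "joint_law C p n"]
    by (auto split: prod.splits)
  also have "pmf (?g xs ys ss) ?z =
      pmf (p xs ys) x * pmf (map_pmf (?h xs ys ss x) (kernel_pmf C x (last ss))) ?z"
    by (rule pmf_bind_single) (use 0 in auto)
  also have "pmf (map_pmf (?h xs ys ss x) (kernel_pmf C x (last ss))) ?z =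
      pmf (kernel_pmf C x (last ss)) (y, s')"
    using pmf_map_inj'[of "?h xs ys ss x" "kernel_pmf C x (last ss)" "(y, s')"]
    by (simp add: inj_def)
  finally show ?thesis .
qed

lemma pmf_joint_law:
  assumes "length xs = n" "length ys = n" "length ss = Suc n"
  shows "pmf (joint_law C p n) (xs, ys, ss) =
    pmf (init_pmf C) (ss ! 0) *
    (\<Prod>t<n. pmf (p (take t xs) (take t ys)) (xs ! t) *
             pmf (kernel_pmf C (xs ! t) (ss ! t)) (ys ! t, ss ! Suc t))"
  using assms
proof (induction n arbitrary: xs ys ss)
  case 0
  then obtain s where "ss = [s]" by (auto simp: length_Suc_conv)
  moreover have "pmf (map_pmf (\<lambda>s. ([] :: bool list, [] :: bool list, [s])) (init_pmf C)) ([], [], [s])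
      = pmf (init_pmf C) s"
    by (rule pmf_map_inj'[where f = "\<lambda>s. ([], [], [s])"]) (simp add: inj_def)
  ultimately show ?case using 0 by simp
next
  case (Suc n)
  obtain xs' x where xs: "xs = xs' @ [x]" using Suc.prems by (cases xs rule: rev_cases) auto
  obtain ys' y where ys: "ys = ys' @ [y]" using Suc.prems by (cases ys rule: rev_cases) auto
  obtain ss' s where ss: "ss = ss' @ [s]" using Suc.prems by (cases ss rule: rev_cases) auto
  have len: "length xs' = n" "length ys' = n" "length ss' = Suc n"
    using Suc.prems by (auto simp: xs ys ss)
  have "last ss' = ss' ! n" using len by (subst last_conv_nth) auto
  then show ?case
    unfolding xs ys ss pmf_joint_law_Suc Suc.IH[OF len]
    using len by (simp add: nth_append mult.assoc cong: prod.cong_simp)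
qed

definition cond_mutual_info :: "'w pmf \<Rightarrow> ('w \<Rightarrow> 'a) \<Rightarrow> ('w \<Rightarrow> 'b) \<Rightarrow> ('w \<Rightarrow> 'c) \<Rightarrow> real" where
  "cond_mutual_info P X Y Z =
     prob_space.conditional_mutual_information (measure_pmf P) 2
       (count_space (range X)) (count_space (range Y)) (count_space (range Z)) X Y Z"

definition directed_info :: "fsc \<Rightarrow> policy \<Rightarrow> nat \<Rightarrow> real" where
  "directed_info C p n =
     (\<Sum>t=1..n. cond_mutual_info (joint_law C p n)
        (\<lambda>(xs, ys, ss). take t xs) (\<lambda>(xs, ys, ss). ys ! (t - 1)) (\<lambda>(xs, ys, ss). take (t - 1) ys))"

definition max_directed_info :: "fsc \<Rightarrow> nat \<Rightarrow> ereal" where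
  "max_directed_info C n = (SUP p. ereal (directed_info C p n))"

definition fb_capacity :: "fsc \<Rightarrow> ereal" where
  "fb_capacity C = limsup (\<lambda>n. max_directed_info C n / ereal (real n))"

text \<open>
  Rational thresholds are coded by natural numbers through the surjection \<open>nat_to_rat_surj\<close>; every
  natural number codes a string and a threshold.
\<close>

definition Cap_semantics :: "expansion \<Rightarrow> fm \<Rightarrow> bool" where
  "Cap_semantics M Cap \<longleftrightarrow>
     (\<forall>e c. true_in M (app Cap [num (string_code e), num c]) \<longleftrightarrow>
            fb_capacity (channel e) \<ge> ereal (real_of_rat (nat_to_rat_surj c)))"

end

theory Submission
  imports Defs
begin

text \<open>
  By Loeb's theorem, reflection for the instances of \<open>Cap\<close> makes \<open>T\<close> prove all of them, in particular
  that the channel with constant output has capacity at least \<open>1\<close>, which soundness forbids.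

  The fixed point in Loeb's theorem needs the function from \<open>m\<close> to the code of the numeral of \<open>m\<close> to be
  representable in \<open>T\<close>. No coding of sequences is required for this: the formula \<open>Sub\<close> of the reflection
  principle represents the function from \<open>m\<close> to the code of \<open>Cap\<close> at \<open>0, m\<close>; since the truth of \<open>Cap\<close>
  depends on the threshold, its second variable occurs in it, and the numeral of \<open>m\<close> sits at a fixed
  place of that code. Reading it off only takes the pairing polynomial, and Robinson arithmetic forces
  summands of standard numbers to be standard.

  Provability is reduced to truth in models by the completeness theorem, so that the arithmetic can be
  done inside models of \<open>T\<close>.
\<close>

section \<open>Substitution\<close>

text \<open>\<open>L\<close> may contain any further symbols, and \<open>Prov\<close>,
  \<open>Sub\<close> and the interpretation are arbitrary formulas whose inner shape is unknown.
  Moreover \<open>Plus\<close> and \<open>Times\<close> of the language need not obey any law in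
  \<open>T\<close>: only the relativized graphs satisfy Robinson arithmetic, and only their zero and
  successor are tied to the numerals. So two structures are kept apart in each model: the model
  itself, over which the quantifiers of \<open>L\<close> range, and the interpreted numbers
  extracted from it. A quantifier may meet elements that are not numbers, and numbers that are
  nonstandard; the auxiliary formulas therefore pin their witnesses down by equations with a
  standard side.

  Diagonalization usually asks for the substitution function. Here self-application is written as
  "for every x, if x is the numeral of m, then C", whose code is assembled by list coding from m,
  the code of its numeral and the code of C. That is why the code of the numeral is the only
  function that has to be found.

  The thresholds 0 and 1 serve because the constant channel has capacity exactly 0: one is met and
  the other is not.\<close>

lemma under_binder_simps [simp]:
  "under_binder \<sigma> 0 = Var 0"
  "under_binder \<sigma> (Suc n) = subst_tm (\<lambda>k. Var (Suc k)) (\<sigma> n)"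
  by (simp_all add: under_binder_def)

lemma subst_tm_cong: "(\<And>n. n \<in> fv_tm t \<Longrightarrow> \<sigma> n = \<tau> n) \<Longrightarrow> subst_tm \<sigma> t = subst_tm \<tau> t"
  by (induction t) auto

lemma subst_cong: "(\<And>n. n \<in> fv A \<Longrightarrow> \<sigma> n = \<tau> n) \<Longrightarrow> subst \<sigma> A = subst \<tau> A"
proof (induction A arbitrary: \<sigma> \<tau>)
  case (Rel r ts)
  then show ?case by (auto intro!: subst_tm_cong)
next
  case (Eq s t)
  then show ?case by (auto intro!: subst_tm_cong)
next
  case (Imp A B)
  show ?case using Imp.IH[of \<sigma> \<tau>] Imp.prems by simp
next
  case (All A)
  have "under_binder \<sigma> n = under_binder \<tau> n" if "n \<in> fv A" for n
    using that All.prems by (cases n) auto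
  with All.IH[of "under_binder \<sigma>" "under_binder \<tau>"] show ?case by simp
qed simp

lemma subst_tm_Var [simp]: "subst_tm Var t = t"
  by (induction t) (auto intro: map_idI)

lemma subst_Var [simp]: "subst Var A = A"
proof (induction A)
  case (All A)
  have "under_binder Var = Var"
    by (rule ext) (simp add: under_binder_def split: nat.split)
  with All show ?case by simp
qed (auto intro: map_idI)

lemma subst_tm_subst_tm: "subst_tm \<sigma> (subst_tm \<tau> t) = subst_tm (\<lambda>n. subst_tm \<sigma> (\<tau> n)) t"
  by (induction t) auto

lemma under_binder_comp:
  "(\<lambda>n. subst_tm (under_binder \<sigma>) (under_binder \<tau> n)) = under_binder (\<lambda>n. subst_tm \<sigma> (\<tau> n))"
proof
  show "subst_tm (under_binder \<sigma>) (under_binder \<tau> n) = under_binder (\<lambda>n. subst_tm \<sigma> (\<tau> n)) n" for n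
    by (cases n) (simp_all add: subst_tm_subst_tm)
qed

lemma subst_subst: "subst \<sigma> (subst \<tau> A) = subst (\<lambda>n. subst_tm \<sigma> (\<tau> n)) A"
  by (induction A arbitrary: \<sigma> \<tau>) (auto simp: subst_tm_subst_tm under_binder_comp)

lemma app_single: "app A [t] = subst (case_nat t Var) A"
  unfolding app_def by (rule arg_cong[where f = "\<lambda>s. subst s A"]) (auto split: nat.split)

lemma subst_app_single: "subst \<sigma> (app A [t]) = app (subst (under_binder \<sigma>) A) [subst_tm \<sigma> t]"
proof -
  have "subst_tm \<sigma> (case_nat t Var n) = subst_tm (case_nat (subst_tm \<sigma> t) Var) (under_binder \<sigma> n)" for n
    by (cases n) (simp_all add: subst_tm_subst_tm)
  then show ?thesis by (simp add: app_single subst_subst)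
qed

text \<open>Links instances of a quantified formula under a substitution with the valuation
  \<open>case_nat a \<rho>\<close> in the clause of \<open>holds\<close> for
  \<open>All\<close>.\<close>

lemma app_subst_under_binder: "app (subst (under_binder \<sigma>) A) [t] = subst (case_nat t \<sigma>) A"
proof -
  have "subst_tm (case_nat t Var) (under_binder \<sigma> n) = case_nat t \<sigma> n" for n
    by (cases n) (simp_all add: subst_tm_subst_tm)
  then show ?thesis by (simp add: app_single subst_subst)
qed

lemma subst_lift: "subst (under_binder \<sigma>) (lift A) = lift (subst \<sigma> A)"
  by (simp add: lift_def subst_subst)

lemma wf_subst_tm: "(\<And>n. wf_tm L (\<sigma> n)) \<Longrightarrow> wf_tm L t \<Longrightarrow> wf_tm L (subst_tm \<sigma> t)"
  by (induction t) auto

lemma wf_under_binder: "(\<And>n. wf_tm L (\<sigma> n)) \<Longrightarrow> wf_tm L (under_binder \<sigma> n)"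
  by (cases n) (auto intro: wf_subst_tm)

lemma wf_subst: "(\<And>n. wf_tm L (\<sigma> n)) \<Longrightarrow> wf_fm L A \<Longrightarrow> wf_fm L (subst \<sigma> A)"
  by (induction A arbitrary: \<sigma>) (auto simp: wf_subst_tm wf_under_binder)

lemma wf_app: "wf_fm L A \<Longrightarrow> (\<And>t. t \<in> set ts \<Longrightarrow> wf_tm L t) \<Longrightarrow> wf_fm L (app A ts)"
  unfolding app_def by (rule wf_subst) auto

lemma wf_lift: "wf_fm L A \<Longrightarrow> wf_fm L (lift A)"
  unfolding lift_def by (rule wf_subst) auto

lemma finite_fv_tm: "finite (fv_tm t)"
  by (induction t) auto

lemma finite_fv: "finite (fv A)"
proof (induction A)
  case (All A)
  have "fv (All A) = Suc -` fv A" by auto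
  then show ?case using All by (simp add: finite_vimageI)
qed (auto simp: finite_fv_tm)

lemma fv_subst_tm: "fv_tm (subst_tm \<sigma> t) = (\<Union>n\<in>fv_tm t. fv_tm (\<sigma> n))"
  by (induction t) auto

lemma fv_subst: "fv (subst \<sigma> A) = (\<Union>n\<in>fv A. fv_tm (\<sigma> n))"
proof (induction A arbitrary: \<sigma>)
  case (All A)
  have *: "(Suc m \<in> fv_tm (under_binder \<sigma> n)) \<longleftrightarrow> (\<exists>k. n = Suc k \<and> m \<in> fv_tm (\<sigma> k))" for m n
    by (cases n) (auto simp: fv_subst_tm)
  show ?case by (auto simp: All * )
qed (auto simp: fv_subst_tm)

lemma fv_num [simp]: "fv_tm (num n) = {}" and wf_num [simp]: "wf_tm L (num n)"
  and subst_num [simp]: "subst_tm \<sigma> (num n) = num n"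
  by (induction n) auto

lemma subst_sentence: "sentence L A \<Longrightarrow> subst \<sigma> A = A"
  using subst_cong[of A \<sigma> Var] by (auto simp: formula_def)

lemma fv_app:
  "formula L (length ts) A \<Longrightarrow> fv (app A ts) \<subseteq> (\<Union>t\<in>set ts. fv_tm t)"
  unfolding formula_def app_def by (fastforce simp: fv_subst split: if_splits)


section \<open>The calculus\<close>

lemma wf_prv: "prv L T A \<Longrightarrow> theory_over L T \<Longrightarrow> wf_fm L A"
  by (induction rule: prv.induct)
    (auto simp: theory_over_def formula_def intro!: wf_app wf_lift)

text \<open>Every axiom scheme is closed under substitution, and the members of \<open>T\<close> are
  sentences. Needed because \<open>Gen\<close> binds only \<open>Var 0\<close>: generalizing over
  another variable goes through a renaming.\<close>

lemma prv_subst: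
  assumes T: "theory_over L T" and "prv L T A" and "\<And>n. wf_tm L (\<sigma> n)"
  shows "prv L T (subst \<sigma> A)"
  using assms(2,3)
proof (induction arbitrary: \<sigma>)
  case (Ax A)
  then have "subst \<sigma> A = A" using T by (auto simp: theory_over_def intro!: subst_sentence)
  then show ?case using Ax by (simp add: prv.Ax)
next
  case (Gen A)
  then have "prv L T (subst (under_binder \<sigma>) A)" by (simp add: wf_under_binder)
  then show ?case by (simp add: prv.Gen)
next
  case (MP A B)
  then have "prv L T (Imp (subst \<sigma> A) (subst \<sigma> B))" "prv L T (subst \<sigma> A)"
    by (metis subst.simps(4), blast)
  then show ?case by (rule prv.MP)
qed (auto simp: subst_app_single subst_lift wf_subst wf_subst_tm wf_under_binder
       intro: prv.ImpK prv.ImpS prv.DNeg prv.AllE prv.AllImp prv.Vac prv.Refl prv.Leibniz)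

text \<open>\<open>Gen\<close> is applied to theorems only, never below hypotheses, so the deduction
  theorem holds with no condition on free variables.\<close>

inductive der :: "lang \<Rightarrow> fm set \<Rightarrow> fm set \<Rightarrow> fm \<Rightarrow> bool" for L T G where
  Hyp: "A \<in> G \<Longrightarrow> wf_fm L A \<Longrightarrow> der L T G A"
| Thm: "prv L T A \<Longrightarrow> der L T G A"
| MP: "der L T G (Imp A B) \<Longrightarrow> der L T G A \<Longrightarrow> der L T G B"

lemma der_mono: "der L T G A \<Longrightarrow> G \<subseteq> H \<Longrightarrow> der L T H A"
  by (induction rule: der.induct) (auto intro: der.intros)

lemma der_finite: "der L T G A \<Longrightarrow> \<exists>F. finite F \<and> F \<subseteq> G \<and> der L T F A"
proof (induction rule: der.induct)
  case (Hyp A)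
  then show ?case by (intro exI[of _ "{A}"]) (auto intro: der.Hyp)
next
  case (Thm A)
  then show ?case by (intro exI[of _ "{}"]) (auto intro: der.Thm)
next
  case (MP A B)
  then obtain F F' where "finite F" "F \<subseteq> G" "der L T F (Imp A B)" "finite F'" "F' \<subseteq> G" "der L T F' A"
    by blast
  then show ?case
    by (intro exI[of _ "F \<union> F'"]) (auto intro: der.MP der_mono)
qed

lemma der_empty: "der L T {} A \<Longrightarrow> prv L T A"
  by (induction rule: der.induct) (auto intro: prv.MP)

context
  fixes L T assumes T: "theory_over L T"
begin

lemma wf_der: "der L T G A \<Longrightarrow> wf_fm L A"
  by (induction rule: der.induct) (auto intro: wf_prv[OF _ T])

lemma der_weaken:
  assumes "der L T G A" "wf_fm L B" shows "der L T G (Imp B A)"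
  by (rule der.MP[OF der.Thm[OF prv.ImpK]]) (use assms wf_der in auto)

lemma der_refl: assumes "wf_fm L B" shows "der L T G (Imp B B)"
  by (rule der.MP[OF der.MP[OF der.Thm[OF prv.ImpS] der.Thm[OF prv.ImpK]] der.Thm[OF prv.ImpK]])
    (use assms in simp_all)

lemma deduction: "der L T (insert B G) A \<Longrightarrow> wf_fm L B \<Longrightarrow> der L T G (Imp B A)"
proof (induction rule: der.induct)
  case (Hyp A)
  then show ?case by (metis der.Hyp der_refl der_weaken insertE)
next
  case (Thm A)
  then show ?case by (metis der.Thm der_weaken)
next
  case (MP A C)
  then have "wf_fm L (Imp A C)" by (meson wf_der)
  then show ?case
    using MP by (auto intro: der.MP[OF der.MP[OF der.Thm[OF prv.ImpS]]])
qed

lemma der_by_contradiction: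
  assumes "der L T (insert (Neg A) G) Fls" "wf_fm L A" shows "der L T G A"
  using deduction[OF assms(1)] assms(2) by (auto intro: der.MP[OF der.Thm[OF prv.DNeg]])

lemma der_Fls: assumes "der L T G Fls" "wf_fm L A" shows "der L T G A"
  by (rule der_by_contradiction) (use assms in \<open>auto intro: der_mono\<close>)

text \<open>The renaming makes \<open>k\<close> the bound variable and shifts all others. On the
  hypotheses it agrees with \<open>lift\<close>, as \<open>k\<close> is not free in them, so
  \<open>Vac\<close> generalizes them.\<close>

lemma der_generalize:
  assumes "der L T G B" and fresh: "\<And>C. C \<in> G \<Longrightarrow> k \<notin> fv C"
  shows "der L T G (All (subst (\<lambda>n. Var (if n = k then 0 else Suc n)) B))"
  using assms(1)
proof induction
  case (Hyp C)
  then have "subst (\<lambda>n. Var (if n = k then 0 else Suc n)) C = lift C"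
    unfolding lift_def using fresh by (intro subst_cong) auto
  with Hyp show ?case by (metis der.Hyp der.MP der.Thm prv.Vac)
next
  case (Thm A)
  then show ?case by (intro der.Thm prv.Gen prv_subst[OF T]) auto
next
  case (MP A B)
  then have "wf_fm L (Imp A B)" by (meson wf_der)
  then have "wf_fm L (subst (\<lambda>n. Var (if n = k then 0 else Suc n)) (Imp A B))"
    by (intro wf_subst) auto
  with MP show ?case by (auto intro: der.MP[OF der.MP[OF der.Thm[OF prv.AllImp]]])
qed

text \<open>The renaming undoes the instantiation by \<open>Var k\<close>, since \<open>k\<close> is
  fresh for the quantified formula.\<close>

lemma der_generalize_app:
  assumes "der L T G (app A [Var k])" and "\<And>C. C \<in> G \<Longrightarrow> k \<notin> fv C" and "k \<notin> fv (All A)"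
  shows "der L T G (All A)"
proof -
  have "subst (\<lambda>n. Var (if n = k then 0 else Suc n)) (app A [Var k]) = subst Var A"
    unfolding app_single subst_subst
    by (rule subst_cong) (use assms(3) in \<open>auto split: nat.split\<close>)
  then show ?thesis using der_generalize[OF assms(1,2)] by simp
qed

end


section \<open>Completeness\<close>

text \<open>Free variables serve as the Henkin constants; axioms of theories have none.\<close>

definition henkin :: "lang \<Rightarrow> fm set \<Rightarrow> fm set \<Rightarrow> bool" where
  "henkin L T G \<longleftrightarrow> \<not> der L T G Fls \<and>
     (\<forall>A. wf_fm L A \<longrightarrow> A \<in> G \<or> Neg A \<in> G) \<and>
     (\<forall>A. wf_fm L A \<longrightarrow> Neg (All A) \<in> G \<longrightarrow> (\<exists>k. Neg (app A [Var k]) \<in> G))"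

text \<open>Stages are kept finite so that some variable is free in none of their formulas and can
  serve as the witness.\<close>

lemma henkin_step:
  assumes T: "theory_over L T" and fin: "finite G" and con: "\<not> der L T G Fls" and wf: "wf_fm L A"
  shows "\<exists>H. finite H \<and> \<not> der L T H Fls \<and> G \<subseteq> H \<and> (A \<in> H \<or> Neg A \<in> H) \<and>
    (\<forall>B. A = Neg (All B) \<longrightarrow> A \<in> H \<longrightarrow> (\<exists>k. Neg (app B [Var k]) \<in> H))"
proof (cases "der L T (insert A G) Fls")
  case True
  have "\<not> der L T (insert (Neg A) G) Fls"
  proof
    assume "der L T (insert (Neg A) G) Fls"
    then have "der L T G A" using der_by_contradiction[OF T] wf by blast
    moreover have "der L T G (Neg A)" using deduction[OF T True wf] .
    ultimately show False using con der.MP by blast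
  qed
  moreover have "A \<notin> G" using True con by (auto simp: insert_absorb)
  \<comment> \<open>\<open>A\<close> differs from \<open>Neg A\<close> by size, so adding
    \<open>Neg A\<close> does not bring in \<open>A\<close>, and no witness is owed.\<close>
  moreover have "size A \<noteq> size (Neg A)" by simp
  then have "A \<noteq> Neg A" by metis
  ultimately show ?thesis using fin by (intro exI[of _ "insert (Neg A) G"]) auto
next
  case False
  show ?thesis
  proof (cases "\<exists>B. A = Neg (All B)")
    case False': False
    then show ?thesis using False fin by (intro exI[of _ "insert A G"]) auto
  next
    case True
    then obtain B where A: "A = Neg (All B)" by blast
    have "finite (fv (All B) \<union> (\<Union>C\<in>insert A G. fv C))" using fin finite_fv by blast
    then obtain k where k: "k \<notin> fv (All B) \<union> (\<Union>C\<in>insert A G. fv C)"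
      using ex_new_if_finite[OF infinite_UNIV_nat] by blast
    have wfB: "wf_fm L (app B [Var k])" "wf_fm L (All B)" using wf A by (auto intro: wf_app)
    have "\<not> der L T (insert (Neg (app B [Var k])) (insert A G)) Fls"
    proof
      assume "der L T (insert (Neg (app B [Var k])) (insert A G)) Fls"
      then have "der L T (insert A G) (app B [Var k])"
        using der_by_contradiction[OF T] wfB by blast
      then have "der L T (insert A G) (All B)"
        by (rule der_generalize_app[OF T]) (use k in auto)
      moreover have "der L T (insert A G) (Neg (All B))" using wf A by (auto intro: der.Hyp)
      ultimately show False using False der.MP by blast
    qed
    then show ?thesis using fin A
      by (intro exI[of _ "insert (Neg (app B [Var k])) (insert A G)"]) auto
  qed
qed

text \<open>Stage \<open>n\<close> treats the formula of code \<open>n\<close>, if there is one;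
  injectivity of codes makes it unique, so the codes enumerate all formulas.\<close>

lemma henkin_extension:
  assumes T: "theory_over L T" and con: "\<not> der L T {A} Fls"
  shows "\<exists>G. A \<in> G \<and> henkin L T G"
proof -
  define Q where "Q n H \<longleftrightarrow> finite H \<and> \<not> der L T H Fls \<and> A \<in> H" for n :: nat and H
  define R where "R n G H \<longleftrightarrow> G \<subseteq> H \<and> (\<forall>A. code A = n \<longrightarrow> wf_fm L A \<longrightarrow> (A \<in> H \<or> Neg A \<in> H) \<and>
    (\<forall>B. A = Neg (All B) \<longrightarrow> A \<in> H \<longrightarrow> (\<exists>k. Neg (app B [Var k]) \<in> H)))" for n G H
  have step: "\<exists>H. Q (Suc n) H \<and> R n G H" if G: "Q n G" for n G
  proof (cases "\<exists>B. code B = n \<and> wf_fm L B")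
    case True
    then obtain B where B: "code B = n" "wf_fm L B" by blast
    obtain H where H: "finite H" "\<not> der L T H Fls" "G \<subseteq> H" "B \<in> H \<or> Neg B \<in> H"
      "\<forall>C. B = Neg (All C) \<longrightarrow> B \<in> H \<longrightarrow> (\<exists>k. Neg (app C [Var k]) \<in> H)"
      using henkin_step[OF T, of G B] B(2) G unfolding Q_def by metis
    have "R n G H"
      unfolding R_def
    proof (intro conjI allI impI)
      show "C \<in> H \<or> Neg C \<in> H" if "code C = n" for C
        using H(4) B(1) code_inj[of C B] that by simp
      show "\<exists>k. Neg (app D [Var k]) \<in> H" if "code C = n" "C = Neg (All D)" "C \<in> H" for C D
        using H(5) B(1) code_inj[of C B] that by simp
    qed (rule H(3))
    then show ?thesis using H G unfolding Q_def by blast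
  next
    case False
    then show ?thesis using G unfolding Q_def R_def by (intro exI[of _ G]) auto
  qed
  have "\<exists>S. \<forall>n. Q n (S n) \<and> R n (S n) (S (Suc n))"
  proof (rule dependent_nat_choice)
    show "\<exists>G. Q 0 G" using con by (intro exI[of _ "{A}"]) (simp add: Q_def)
  qed (rule step)
  then obtain S where "\<forall>n. Q n (S n) \<and> R n (S n) (S (Suc n))" ..
  then have S: "Q n (S n)" "R n (S n) (S (Suc n))" for n by simp_all
  define G where "G = (\<Union>n. S n)"
  have S_mono: "S n \<subseteq> S (Suc n)" for n
    using S(2)[of n] unfolding R_def by (rule conjunct1)
  have complete: "B \<in> S (Suc n) \<or> Neg B \<in> S (Suc n)" if "code B = n" "wf_fm L B" for B n
    using S(2)[of n, unfolded R_def, THEN conjunct2, rule_format, OF that] by (rule conjunct1)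
  have witness: "\<exists>k. Neg (app B [Var k]) \<in> S (Suc n)"
    if "code (Neg (All B)) = n" "wf_fm L (Neg (All B))" "Neg (All B) \<in> S (Suc n)" for B n
    using S(2)[of n, unfolded R_def, THEN conjunct2, rule_format, OF that(1,2)] that(3) by blast
  have "mono S" using S_mono by (simp add: mono_iff_le_Suc)
  have "\<not> der L T G Fls"
  proof
    assume "der L T G Fls"
    from der_finite[OF this] obtain F where F: "finite F" "F \<subseteq> G" "der L T F Fls" by blast
    have "\<exists>n. F \<subseteq> S n"
      using F(1,2)
    proof induction
      case (insert x F)
      then obtain m n where "F \<subseteq> S n" "x \<in> S m" by (auto simp: G_def)
      then have "insert x F \<subseteq> S (max m n)"
        using monoD[OF \<open>mono S\<close>, of m "max m n"] monoD[OF \<open>mono S\<close>, of n "max m n"] by auto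
      then show ?case by blast
    qed simp
    then obtain n where "F \<subseteq> S n" ..
    then show False using der_mono[OF F(3)] S(1)[of n] by (simp add: Q_def)
  qed
  moreover have "B \<in> G \<or> Neg B \<in> G" if "wf_fm L B" for B
    using complete[OF refl that] unfolding G_def by blast
  moreover have "\<exists>k. Neg (app B [Var k]) \<in> G" if "wf_fm L B" "Neg (All B) \<in> G" for B
  proof -
    let ?n = "code (Neg (All B))"
    \<comment> \<open>A witness is supplied only at the stage that decides
      \<open>Neg (All B)\<close>. Had the formula been absent then, its negation would have been
      added, and both would lie in \<open>G\<close>.\<close>
    have "Neg (All B) \<in> S (Suc ?n)"
    proof (rule ccontr)
      assume "Neg (All B) \<notin> S (Suc ?n)"
      then have "Neg (Neg (All B)) \<in> G"
        using complete[OF refl, of "Neg (All B)"] that unfolding G_def by auto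
      then have "der L T G (Neg (Neg (All B)))" "der L T G (Neg (All B))"
        using that by (auto intro: der.Hyp)
      with \<open>\<not> der L T G Fls\<close> show False using der.MP by blast
    qed
    then have "\<exists>k. Neg (app B [Var k]) \<in> S (Suc ?n)" using witness[OF refl] that by simp
    then show ?thesis unfolding G_def by blast
  qed
  moreover have "A \<in> G" using S(1)[of 0] by (auto simp: Q_def G_def)
  ultimately show ?thesis unfolding henkin_def by (intro exI[of _ G] conjI allI impI) assumption+
qed

section \<open>Structures for the language and truth in them\<close>

record 'u struc =
  carr :: "'u set"
  zeroS :: 'u
  succS :: "'u \<Rightarrow> 'u"
  plusS :: "'u \<Rightarrow> 'u \<Rightarrow> 'u"
  timesS :: "'u \<Rightarrow> 'u \<Rightarrow> 'u"
  funS :: "nat \<Rightarrow> 'u list \<Rightarrow> 'u"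
  relS :: "nat \<Rightarrow> 'u list \<Rightarrow> bool"

fun eval :: "'u struc \<Rightarrow> (nat \<Rightarrow> 'u) \<Rightarrow> tm \<Rightarrow> 'u" where
  "eval N \<rho> (Var n) = \<rho> n"
| "eval N \<rho> Zero = zeroS N"
| "eval N \<rho> (Succ t) = succS N (eval N \<rho> t)"
| "eval N \<rho> (Plus s t) = plusS N (eval N \<rho> s) (eval N \<rho> t)"
| "eval N \<rho> (Times s t) = timesS N (eval N \<rho> s) (eval N \<rho> t)"
| "eval N \<rho> (Fn f ts) = funS N f (map (eval N \<rho>) ts)"

fun holds :: "'u struc \<Rightarrow> (nat \<Rightarrow> 'u) \<Rightarrow> fm \<Rightarrow> bool" where
  "holds N \<rho> Fls = False"
| "holds N \<rho> (Eq s t) = (eval N \<rho> s = eval N \<rho> t)"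
| "holds N \<rho> (Rel r ts) = relS N r (map (eval N \<rho>) ts)"
| "holds N \<rho> (Imp A B) = (holds N \<rho> A \<longrightarrow> holds N \<rho> B)"
| "holds N \<rho> (All A) = (\<forall>a\<in>carr N. holds N (case_nat a \<rho>) A)"

lemma range_case_nat: "range \<rho> \<subseteq> C \<Longrightarrow> a \<in> C \<Longrightarrow> range (case_nat a \<rho>) \<subseteq> C"
proof
  show "x \<in> C" if "x \<in> range (case_nat a \<rho>)" "range \<rho> \<subseteq> C" "a \<in> C" for x
  proof -
    from that(1) obtain n where "x = case_nat a \<rho> n" by blast
    then show ?thesis using that(2,3) by (cases n) auto
  qed
qed

text \<open>All theorems are required to hold, not just the axioms, so that provable formulas can be
  used in a model without a soundness proof for the calculus. Closure of the carrier concerns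
  well-formed terms only; symbols outside \<open>L\<close> may take any values.\<close>

definition model :: "lang \<Rightarrow> fm set \<Rightarrow> 'u struc \<Rightarrow> bool" where
  "model L T N \<longleftrightarrow> carr N \<noteq> {} \<and>
     (\<forall>t \<rho>. wf_tm L t \<longrightarrow> range \<rho> \<subseteq> carr N \<longrightarrow> eval N \<rho> t \<in> carr N) \<and>
     (\<forall>A \<rho>. prv L T A \<longrightarrow> range \<rho> \<subseteq> carr N \<longrightarrow> holds N \<rho> A)"

context
  fixes L T G
  assumes T: "theory_over L T" and G: "henkin L T G"
begin

lemma henkin_con: "\<not> der L T G Fls"
  using G unfolding henkin_def by (rule conjunct1)

lemma henkin_complete: "wf_fm L A \<Longrightarrow> A \<in> G \<or> Neg A \<in> G"
  using G[unfolded henkin_def, THEN conjunct2, THEN conjunct1, rule_format, of A] .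

lemma henkin_witness: "wf_fm L A \<Longrightarrow> Neg (All A) \<in> G \<Longrightarrow> \<exists>k. Neg (app A [Var k]) \<in> G"
  using G[unfolded henkin_def, THEN conjunct2, THEN conjunct2, rule_format, of A] .

lemma henkin_closed: "der L T G A \<Longrightarrow> A \<in> G"
proof -
  assume A: "der L T G A"
  then have wf: "wf_fm L A" by (rule wf_der[OF T])
  have "Neg A \<notin> G"
  proof
    assume "Neg A \<in> G"
    then have "der L T G (Neg A)" by (rule der.Hyp) (simp add: wf)
    then have "der L T G Fls" using A by (rule der.MP)
    then show False using henkin_con by contradiction
  qed
  then show ?thesis using henkin_complete[OF wf] by simp
qed

lemma henkin_MP:
  assumes "Imp A B \<in> G" "A \<in> G" "wf_fm L (Imp A B)"
  shows "B \<in> G"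
proof -
  have "der L T G (Imp A B)" "der L T G A" using assms by (auto intro: der.Hyp)
  then have "der L T G B" by (rule der.MP)
  then show ?thesis by (rule henkin_closed)
qed

lemma henkin_Fls: "Fls \<notin> G"
  using henkin_con der.Hyp[of Fls G L T] by auto

lemma henkin_Imp:
  assumes wf: "wf_fm L A" "wf_fm L B"
  shows "Imp A B \<in> G \<longleftrightarrow> (A \<in> G \<longrightarrow> B \<in> G)"
proof
  show "A \<in> G \<longrightarrow> B \<in> G" if "Imp A B \<in> G" using that wf henkin_MP by simp
  assume AB: "A \<in> G \<longrightarrow> B \<in> G"
  have "der L T G (Imp A B)"
  proof (cases "A \<in> G")
    case True
    then have "der L T G B" using AB wf by (intro der.Hyp) auto
    then show ?thesis using der_weaken[OF T] wf by blast
  next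
    case False
    then have "Neg A \<in> G" using henkin_complete[OF wf(1)] by simp
    then have "der L T (insert A G) (Neg A)" "der L T (insert A G) A"
      using wf by (auto intro: der.Hyp)
    then have "der L T (insert A G) Fls" by (rule der.MP)
    then have "der L T (insert A G) B" using der_Fls[OF T] wf by blast
    then show ?thesis using deduction[OF T] wf by blast
  qed
  then show "Imp A B \<in> G" by (rule henkin_closed)
qed

lemma henkin_All:
  assumes wf: "wf_fm L A"
  shows "All A \<in> G \<longleftrightarrow> (\<forall>t. wf_tm L t \<longrightarrow> app A [t] \<in> G)"
proof
  show "\<forall>t. wf_tm L t \<longrightarrow> app A [t] \<in> G" if "All A \<in> G"
  proof (intro allI impI)
    fix t assume "wf_tm L t"
    then show "app A [t] \<in> G"
      by (intro henkin_closed der.MP[OF der.Thm[OF prv.AllE[OF wf]] der.Hyp[OF that]]) (simp_all add: wf)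
  qed
  assume *: "\<forall>t. wf_tm L t \<longrightarrow> app A [t] \<in> G"
  show "All A \<in> G"
  proof (rule ccontr)
    assume "All A \<notin> G"
    then have "Neg (All A) \<in> G" using henkin_complete[of "All A"] wf by simp
    then obtain k where k: "Neg (app A [Var k]) \<in> G" using henkin_witness[OF wf] by blast
    have "app A [Var k] \<in> G" using * by simp
    then have "Fls \<in> G" using k wf by (intro henkin_MP[of "app A [Var k]" Fls]) (auto intro: wf_app)
    then show False using henkin_Fls by simp
  qed
qed

section \<open>Equality in a Henkin set as a congruence, and the term model\<close>

definition eqv :: "tm \<Rightarrow> tm \<Rightarrow> bool" where
  "eqv s t \<longleftrightarrow> wf_tm L s \<and> wf_tm L t \<and> Eq s t \<in> G"

lemma henkin_Leibniz:
  assumes "eqv s t" "wf_fm L A" "app A [s] \<in> G" shows "app A [t] \<in> G"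
proof -
  have wf: "wf_tm L s" "wf_tm L t" "wf_fm L (app A [s])" "wf_fm L (app A [t])"
    using assms by (auto simp: eqv_def intro: wf_app)
  have "Imp (Eq s t) (Imp (app A [s]) (app A [t])) \<in> G"
    using assms wf by (intro henkin_closed der.Thm prv.Leibniz)
  then show ?thesis using assms wf by (simp add: henkin_Imp eqv_def)
qed

lemma eqv_refl: "wf_tm L t \<Longrightarrow> eqv t t"
  unfolding eqv_def by (auto intro: henkin_closed der.Thm prv.Refl)

lemma wf_case_nat: "wf_tm L t \<Longrightarrow> wf_tm L (case_nat t Var n)"
  by (cases n) auto

text \<open>\<open>Var 0\<close> marks the place of replacement in \<open>u\<close>. The congruence
  lemmas for terms are instances of this one, which is Leibniz's law for the equation between the
  old value of \<open>u\<close> and \<open>u\<close> itself.\<close>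

lemma eqv_context:
  assumes "eqv s t" "wf_tm L u"
  shows "eqv (subst_tm (case_nat s Var) u) (subst_tm (case_nat t Var) u)"
proof -
  let ?u = "subst_tm (case_nat s Var) u"
  have wf: "wf_tm L s" "wf_tm L t" using assms by (auto simp: eqv_def)
  then have wf': "wf_tm L ?u" "wf_tm L (subst_tm (case_nat t Var) u)"
    using assms(2) by (auto intro!: wf_subst_tm wf_case_nat)
  have *: "app (Eq (subst_tm (\<lambda>n. Var (Suc n)) ?u) u) [r] = Eq ?u (subst_tm (case_nat r Var) u)" for r
    by (simp add: app_single subst_tm_subst_tm)
  have "app (Eq (subst_tm (\<lambda>n. Var (Suc n)) ?u) u) [s] \<in> G"
    unfolding * using wf' by (intro henkin_closed der.Thm prv.Refl)
  then have "app (Eq (subst_tm (\<lambda>n. Var (Suc n)) ?u) u) [t] \<in> G"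
    by (rule henkin_Leibniz[OF assms(1), rotated]) (use assms(2) wf' in \<open>auto intro!: wf_subst_tm\<close>)
  then show ?thesis unfolding * using wf' by (simp add: eqv_def)
qed

lemma eqv_sym: assumes "eqv s t" shows "eqv t s"
proof -
  let ?A = "Eq (Var 0) (subst_tm (\<lambda>n. Var (Suc n)) s)"
  have wf: "wf_tm L s" "wf_tm L t" using assms by (auto simp: eqv_def)
  have "app ?A [s] \<in> G"
    using eqv_refl[OF wf(1)] by (simp add: app_single subst_tm_subst_tm eqv_def)
  then have "app ?A [t] \<in> G"
    by (rule henkin_Leibniz[OF assms, rotated]) (use wf in \<open>auto intro!: wf_subst_tm\<close>)
  then show ?thesis using wf by (simp add: app_single subst_tm_subst_tm eqv_def)
qed

lemma eqv_trans: assumes "eqv r s" "eqv s t" shows "eqv r t"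
proof -
  let ?A = "Eq (subst_tm (\<lambda>n. Var (Suc n)) r) (Var 0)"
  have wf: "wf_tm L r" "wf_tm L s" "wf_tm L t" using assms by (auto simp: eqv_def)
  have "app ?A [s] \<in> G"
    using assms(1) by (simp add: app_single subst_tm_subst_tm eqv_def)
  then have "app ?A [t] \<in> G"
    by (rule henkin_Leibniz[OF assms(2), rotated]) (use wf in \<open>auto intro!: wf_subst_tm\<close>)
  then show ?thesis using wf by (simp add: app_single subst_tm_subst_tm eqv_def)
qed

abbreviation shift :: "tm \<Rightarrow> tm" where "shift \<equiv> subst_tm (\<lambda>n. Var (Suc n))"

lemma subst_shift: "subst_tm (case_nat s Var) (shift t) = t"
  by (simp add: subst_tm_subst_tm)

lemma wf_shift: "wf_tm L t \<Longrightarrow> wf_tm L (shift t)"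
  by (rule wf_subst_tm) auto

lemma eqv_Succ: "eqv s t \<Longrightarrow> eqv (Succ s) (Succ t)"
  using eqv_context[of s t "Succ (Var 0)"] by simp

lemma eqv_Plus: assumes "eqv s s'" "eqv t t'" shows "eqv (Plus s t) (Plus s' t')"
proof (rule eqv_trans)
  have "wf_tm L t" "wf_tm L s'" using assms by (auto simp: eqv_def)
  then show "eqv (Plus s t) (Plus s' t)" "eqv (Plus s' t) (Plus s' t')"
    using eqv_context[OF assms(1), of "Plus (Var 0) (shift t)"]
      eqv_context[OF assms(2), of "Plus (shift s') (Var 0)"]
    by (simp_all add: subst_shift wf_shift)
qed

lemma eqv_Times: assumes "eqv s s'" "eqv t t'" shows "eqv (Times s t) (Times s' t')"
proof (rule eqv_trans)
  have "wf_tm L t" "wf_tm L s'" using assms by (auto simp: eqv_def)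
  then show "eqv (Times s t) (Times s' t)" "eqv (Times s' t) (Times s' t')"
    using eqv_context[OF assms(1), of "Times (Var 0) (shift t)"]
      eqv_context[OF assms(2), of "Times (shift s') (Var 0)"]
    by (simp_all add: subst_shift wf_shift)
qed

lemma list_all2_eqv_wf: "list_all2 eqv ts ts' \<Longrightarrow> (\<forall>t\<in>set ts. wf_tm L t) \<and> (\<forall>t\<in>set ts'. wf_tm L t)"
  by (induction rule: list_all2_induct) (auto simp: eqv_def)

text \<open>Arguments are exchanged one at a time; \<open>us\<close> collects those already
  exchanged and has to be general for the induction.\<close>

lemma eqv_Fn:
  assumes "list_all2 eqv ts ts'" "\<forall>t\<in>set us. wf_tm L t" "(f, length us + length ts) \<in> funs L"
  shows "eqv (Fn f (us @ ts)) (Fn f (us @ ts'))"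
  using assms
proof (induction arbitrary: us rule: list_all2_induct)
  case Nil
  then show ?case by (auto intro: eqv_refl)
next
  case (Cons t ts t' ts')
  have wf: "wf_tm L t" "wf_tm L t'" "\<forall>t\<in>set ts. wf_tm L t" "length ts = length ts'"
    using Cons.hyps list_all2_eqv_wf[of ts ts'] by (auto simp: eqv_def list_all2_lengthD)
  have "wf_tm L (Fn f (map shift us @ Var 0 # map shift ts))"
    using Cons.prems wf by (auto intro!: wf_shift)
  from eqv_context[OF Cons.hyps(1) this]
  have "eqv (Fn f (us @ t # ts)) (Fn f (us @ t' # ts))"
    by (simp add: subst_shift comp_def)
  moreover have "eqv (Fn f ((us @ [t']) @ ts)) (Fn f ((us @ [t']) @ ts'))"
    by (rule Cons.IH) (use Cons.prems wf in auto)
  ultimately show ?case by (auto intro: eqv_trans)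
qed

lemma eqv_Rel:
  assumes "list_all2 eqv ts ts'" "\<forall>t\<in>set us. wf_tm L t" "(r, length us + length ts) \<in> rels L"
    and "Rel r (us @ ts) \<in> G"
  shows "Rel r (us @ ts') \<in> G"
  using assms
proof (induction arbitrary: us rule: list_all2_induct)
  case Nil
  then show ?case by simp
next
  case (Cons t ts t' ts')
  have wf: "wf_tm L t" "wf_tm L t'" "\<forall>t\<in>set ts. wf_tm L t" "length ts = length ts'"
    using Cons.hyps list_all2_eqv_wf[of ts ts'] by (auto simp: eqv_def list_all2_lengthD)
  let ?A = "Rel r (map shift us @ Var 0 # map shift ts)"
  have *: "app ?A [s] = Rel r (us @ s # ts)" for s
    by (simp add: app_single subst_shift comp_def)
  have "app ?A [t'] \<in> G"
    by (rule henkin_Leibniz[OF Cons.hyps(1)]) (use Cons.prems wf in \<open>auto simp: * intro!: wf_shift\<close>)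
  then have "Rel r ((us @ [t']) @ ts') \<in> G"
    by (intro Cons.IH) (use Cons.prems wf in \<open>auto simp: *\<close>)
  then show ?case by simp
qed

text \<open>Classes are represented by chosen terms, which keeps the term model on the type
  \<open>tm\<close>. The choice depends on the class only, because equivalent terms have equal
  predicates \<open>eqv\<close>.\<close>

definition rep :: "tm \<Rightarrow> tm" where
  "rep t = (SOME s. eqv t s)"

lemma eqv_rep: "wf_tm L t \<Longrightarrow> eqv t (rep t)"
  unfolding rep_def by (rule someI[of _ t]) (rule eqv_refl)

lemma wf_rep: "wf_tm L t \<Longrightarrow> wf_tm L (rep t)"
  using eqv_rep by (auto simp: eqv_def)

lemma rep_eq_iff: 
  assumes "wf_tm L s" "wf_tm L t"
  shows "rep s = rep t \<longleftrightarrow> eqv s t"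
proof
  show "eqv s t" if "rep s = rep t"
    using eqv_rep[OF assms(1)] eqv_sym[OF eqv_rep[OF assms(2)]] that by (auto intro: eqv_trans)
  assume st: "eqv s t"
  have "eqv s = eqv t"
    by (intro ext) (use st eqv_sym eqv_trans in blast)
  then show "rep s = rep t" by (simp add: rep_def)
qed

definition term_model :: "tm struc" where
  "term_model = \<lparr>carr = rep ` {t. wf_tm L t}, zeroS = rep Zero, succS = (\<lambda>a. rep (Succ a)),
     plusS = (\<lambda>a b. rep (Plus a b)), timesS = (\<lambda>a b. rep (Times a b)),
     funS = (\<lambda>f as. rep (Fn f as)), relS = (\<lambda>r as. Rel r as \<in> G)\<rparr>"

lemma term_model_simps:
  "carr term_model = rep ` {t. wf_tm L t}" "zeroS term_model = rep Zero"
  "succS term_model a = rep (Succ a)" "plusS term_model a b = rep (Plus a b)"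
  "timesS term_model a b = rep (Times a b)" "funS term_model f as = rep (Fn f as)"
  "relS term_model r as \<longleftrightarrow> Rel r as \<in> G"
  by (simp_all add: term_model_def)

lemma carr_term_model: "a \<in> carr term_model \<Longrightarrow> wf_tm L a \<and> rep a = a"
proof -
  assume "a \<in> carr term_model"
  then obtain t where t: "a = rep t" "wf_tm L t" by (auto simp: term_model_simps)
  then have "rep (rep t) = rep t" using rep_eq_iff[of "rep t" t] wf_rep eqv_rep eqv_sym by blast
  then show ?thesis using t wf_rep by simp
qed

lemma range_term_model:
  assumes "range \<rho> \<subseteq> carr term_model"
  shows "wf_tm L (\<rho> n)" "rep (\<rho> n) = \<rho> n"
proof -
  have "\<rho> n \<in> carr term_model" using assms by blast
  note * = carr_term_model[OF this]
  show "wf_tm L (\<rho> n)" by (rule conjunct1[OF *])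
  show "rep (\<rho> n) = \<rho> n" by (rule conjunct2[OF *])
qed

lemma rep_rep: "wf_tm L t \<Longrightarrow> eqv (rep t) t"
  by (rule eqv_sym[OF eqv_rep])

text \<open>The elements are terms, so a valuation is itself a substitution.\<close>

lemma eval_term_model:
  assumes \<rho>: "range \<rho> \<subseteq> carr term_model"
  shows "wf_tm L t \<Longrightarrow> eval term_model \<rho> t = rep (subst_tm \<rho> t)"
proof (induction t)
  case (Var n)
  then show ?case using range_term_model[OF \<rho>] by simp
next
  case Zero
  then show ?case by (simp add: term_model_simps)
next
  case (Succ t)
  have "wf_tm L (subst_tm \<rho> t)" using Succ.prems range_term_model(1)[OF \<rho>] by (auto intro: wf_subst_tm)
  then have "rep (Succ (rep (subst_tm \<rho> t))) = rep (Succ (subst_tm \<rho> t))"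
    by (subst rep_eq_iff) (auto intro: eqv_Succ rep_rep wf_rep)
  with Succ show ?case by (simp add: term_model_simps)
next
  case (Plus s t)
  have "wf_tm L (subst_tm \<rho> s)" "wf_tm L (subst_tm \<rho> t)"
    using Plus.prems range_term_model(1)[OF \<rho>] by (auto intro: wf_subst_tm)
  then have "rep (Plus (rep (subst_tm \<rho> s)) (rep (subst_tm \<rho> t))) = rep (Plus (subst_tm \<rho> s) (subst_tm \<rho> t))"
    by (subst rep_eq_iff) (auto intro: eqv_Plus rep_rep wf_rep)
  with Plus show ?case by (simp add: term_model_simps)
next
  case (Times s t)
  have "wf_tm L (subst_tm \<rho> s)" "wf_tm L (subst_tm \<rho> t)"
    using Times.prems range_term_model(1)[OF \<rho>] by (auto intro: wf_subst_tm)
  then have "rep (Times (rep (subst_tm \<rho> s)) (rep (subst_tm \<rho> t))) = rep (Times (subst_tm \<rho> s) (subst_tm \<rho> t))"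
    by (subst rep_eq_iff) (auto intro: eqv_Times rep_rep wf_rep)
  with Times show ?case by (simp add: term_model_simps)
next
  case (Fn f ts)
  have wf: "wf_tm L (subst_tm \<rho> t)" if "t \<in> set ts" for t
    using Fn.prems that range_term_model(1)[OF \<rho>] by (auto intro: wf_subst_tm)
  then have "list_all2 eqv (map (\<lambda>t. rep (subst_tm \<rho> t)) ts) (map (subst_tm \<rho>) ts)"
    by (auto simp: list_all2_map1 list_all2_map2 intro!: list_all2_refl rep_rep list.rel_refl_strong)
  from eqv_Fn[OF this, of "[]" f]
  have "rep (Fn f (map (\<lambda>t. rep (subst_tm \<rho> t)) ts)) = rep (Fn f (map (subst_tm \<rho>) ts))"
    using Fn.prems wf by (subst rep_eq_iff) (auto intro: wf_rep)
  moreover have "map (eval term_model \<rho>) ts = map (\<lambda>t. rep (subst_tm \<rho> t)) ts"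
    using Fn by auto
  ultimately show ?case by (simp only: subst_tm.simps eval.simps term_model_simps)
qed

text \<open>The truth lemma. Quantifiers range over representatives, while \<open>henkin_All\<close>
  speaks of all terms; Leibniz's law bridges the two.\<close>

lemma holds_term_model:
  assumes "range \<rho> \<subseteq> carr term_model" and "wf_fm L A"
  shows "holds term_model \<rho> A \<longleftrightarrow> subst \<rho> A \<in> G"
  using assms
proof (induction A arbitrary: \<rho>)
  case Fls
  then show ?case by (simp add: henkin_Fls)
next
  case (Eq s t)
  have "wf_tm L (subst_tm \<rho> s)" "wf_tm L (subst_tm \<rho> t)"
    using Eq.prems range_term_model(1)[OF Eq.prems(1)] by (auto intro: wf_subst_tm)
  then show ?case using Eq.prems by (simp add: eval_term_model rep_eq_iff) (simp add: eqv_def)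
next
  case (Rel r ts)
  have wf: "wf_tm L (subst_tm \<rho> t)" if "t \<in> set ts" for t
    using Rel.prems that range_term_model(1)[OF Rel.prems(1)] by (auto intro: wf_subst_tm)
  then have eqv: "list_all2 eqv (map (\<lambda>t. rep (subst_tm \<rho> t)) ts) (map (subst_tm \<rho>) ts)"
      "list_all2 eqv (map (subst_tm \<rho>) ts) (map (\<lambda>t. rep (subst_tm \<rho> t)) ts)"
    by (auto simp: list_all2_map1 list_all2_map2 intro!: eqv_rep rep_rep list.rel_refl_strong)
  have "map (eval term_model \<rho>) ts = map (\<lambda>t. rep (subst_tm \<rho> t)) ts"
    using Rel.prems by (auto simp: eval_term_model)
  then have "holds term_model \<rho> (Rel r ts) \<longleftrightarrow> Rel r (map (\<lambda>t. rep (subst_tm \<rho> t)) ts) \<in> G"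
    by (simp only: holds.simps term_model_simps)
  also have "\<dots> \<longleftrightarrow> Rel r (map (subst_tm \<rho>) ts) \<in> G"
    using eqv_Rel[OF eqv(1), of "[]" r] eqv_Rel[OF eqv(2), of "[]" r] Rel.prems by auto
  finally show ?case by simp
next
  case (Imp A B)
  then have "wf_fm L (subst \<rho> A)" "wf_fm L (subst \<rho> B)"
    using range_term_model(1)[OF Imp.prems(1)] by (auto intro: wf_subst)
  with Imp show ?case by (simp add: henkin_Imp)
next
  case (All A)
  have wf\<rho>: "wf_tm L (\<rho> n)" for n by (rule range_term_model(1)[OF All.prems(1)])
  have wfA: "wf_fm L (subst (under_binder \<rho>) A)"
    using All.prems wf\<rho> by (intro wf_subst wf_under_binder) auto
  have "holds term_model \<rho> (All A) \<longleftrightarrow> (\<forall>a\<in>carr term_model. app (subst (under_binder \<rho>) A) [a] \<in> G)"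
  proof -
    have "holds term_model (case_nat a \<rho>) A \<longleftrightarrow> app (subst (under_binder \<rho>) A) [a] \<in> G"
      if "a \<in> carr term_model" for a
      unfolding app_subst_under_binder
      using All.prems by (intro All.IH range_case_nat that) auto
    then show ?thesis by simp
  qed
  also have "\<dots> \<longleftrightarrow> (\<forall>t. wf_tm L t \<longrightarrow> app (subst (under_binder \<rho>) A) [rep t] \<in> G)"
    by (auto simp: term_model_simps)
  also have "\<dots> \<longleftrightarrow> (\<forall>t. wf_tm L t \<longrightarrow> app (subst (under_binder \<rho>) A) [t] \<in> G)"
    using henkin_Leibniz[OF eqv_rep wfA] henkin_Leibniz[OF rep_rep wfA] by blast
  also have "\<dots> \<longleftrightarrow> subst \<rho> (All A) \<in> G"
    by (simp add: henkin_All[OF wfA])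
  finally show ?case .
qed

text \<open>Evaluating a theorem with free variables amounts to taking a substitution instance,
  which is again a theorem.\<close>

lemma model_term_model: "model L T term_model"
  unfolding model_def
proof (intro conjI allI impI)
  show "carr term_model \<noteq> {}" by (auto simp: term_model_simps intro: exI[of _ Zero])
next
  fix t and \<rho> :: "nat \<Rightarrow> tm" assume "wf_tm L t" and \<rho>: "range \<rho> \<subseteq> carr term_model"
  moreover from this have "wf_tm L (subst_tm \<rho> t)" 
    using range_term_model(1)[OF \<rho>] by (auto intro: wf_subst_tm)
  ultimately show "eval term_model \<rho> t \<in> carr term_model" by (simp add: eval_term_model) (simp add: term_model_simps)
next
  fix A and \<rho> :: "nat \<Rightarrow> tm" assume A: "prv L T A" and \<rho>: "range \<rho> \<subseteq> carr term_model"
  have "prv L T (subst \<rho> A)" using prv_subst[OF T A] range_term_model(1)[OF \<rho>] by blast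
  then show "holds term_model \<rho> A"
    using holds_term_model[OF \<rho> wf_prv[OF A T]] by (auto intro: henkin_closed der.Thm)
qed

end

lemma completeness:
  assumes T: "theory_over L T" and wf: "sentence L A"
    and valid: "\<And>N :: tm struc. \<And>\<rho>. model L T N \<Longrightarrow> range \<rho> \<subseteq> carr N \<Longrightarrow> holds N \<rho> A"
  shows "prv L T A"
proof (rule ccontr)
  assume "\<not> prv L T A"
  moreover have wf': "wf_fm L A" using wf by (simp add: formula_def)
  ultimately have "\<not> der L T {Neg A} Fls"
    using der_by_contradiction[OF T, of A "{}"] der_empty[of L T A] by auto
  from henkin_extension[OF T this] obtain G where G: "Neg A \<in> G" "henkin L T G" by blast
  obtain a where "a \<in> carr (term_model L G)"
    using model_term_model[OF T G(2)] by (auto simp: model_def)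
  then have a: "range (\<lambda>n. a) \<subseteq> carr (term_model L G)" by auto
  from valid[OF model_term_model[OF T G(2)] a] have "holds (term_model L G) (\<lambda>n. a) A" .
  then have "A \<in> G"
    using holds_term_model[OF T G(2) a wf'] subst_sentence[OF wf] by simp
  then have "Fls \<in> G" using henkin_MP[OF T G(2,1)] wf' by simp
  then show False using henkin_Fls[OF T G(2)] by simp
qed

section \<open>Models of theories interpreting Robinson arithmetic\<close>

lemma eval_subst_tm: "eval N \<rho> (subst_tm \<sigma> t) = eval N (\<lambda>n. eval N \<rho> (\<sigma> n)) t"
  by (induction t) (auto simp: comp_def cong: map_cong)

lemma holds_subst: "holds N \<rho> (subst \<sigma> A) = holds N (\<lambda>n. eval N \<rho> (\<sigma> n)) A"
proof (induction A arbitrary: \<rho> \<sigma>)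
  case (All A)
  have "(\<lambda>n. eval N (case_nat a \<rho>) (under_binder \<sigma> n)) = case_nat a (\<lambda>n. eval N \<rho> (\<sigma> n))" for a
    by (rule ext) (simp add: eval_subst_tm under_binder_def split: nat.split)
  then show ?case by (simp add: All.IH)
qed (simp_all add: eval_subst_tm comp_def)

lemma eval_cong: "(\<And>n. n \<in> fv_tm t \<Longrightarrow> \<rho> n = \<rho>' n) \<Longrightarrow> eval N \<rho> t = eval N \<rho>' t"
proof (induction t)
  case (Fn f ts)
  have "map (eval N \<rho>) ts = map (eval N \<rho>') ts"
    by (rule map_cong[OF refl], rule Fn.IH) (use Fn.prems in auto)
  then show ?case by (simp only: eval.simps)
qed auto

lemma holds_cong: "(\<And>n. n \<in> fv A \<Longrightarrow> \<rho> n = \<rho>' n) \<Longrightarrow> holds N \<rho> A = holds N \<rho>' A"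
proof (induction A arbitrary: \<rho> \<rho>')
  case (Eq s t)
  then show ?case using eval_cong[of s \<rho> \<rho>' N] eval_cong[of t \<rho> \<rho>' N] by simp
next
  case (Rel r ts)
  then have "map (eval N \<rho>) ts = map (eval N \<rho>') ts" by (auto intro!: eval_cong)
  then show ?case by (simp only: holds.simps)
next
  case (Imp A B)
  from Imp.IH[of \<rho> \<rho>'] Imp.prems show ?case by simp
next
  case (All A)
  have "holds N (case_nat a \<rho>) A = holds N (case_nat a \<rho>') A" for a
    by (rule All.IH) (use All.prems in \<open>auto split: nat.split\<close>)
  then show ?case by simp
qed simp

lemma holds_Iff: "holds N \<rho> (Iff A B) \<longleftrightarrow> (holds N \<rho> A \<longleftrightarrow> holds N \<rho> B)"
  by auto

text \<open>Positions beyond the end of the list have unspecified values; this is harmless for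
  formulas whose free variables lie below its length.\<close>

definition pred :: "'u struc \<Rightarrow> fm \<Rightarrow> 'u list \<Rightarrow> bool" where
  "pred N A as = holds N (\<lambda>n. as ! n) A"

lemma holds_app:
  assumes "formula L k A" "length ts = k"
  shows "holds N \<rho> (app A ts) = pred N A (map (eval N \<rho>) ts)"
  unfolding app_def holds_subst pred_def
  by (rule holds_cong) (use assms in \<open>auto simp: formula_def\<close>)

definition numv :: "'u struc \<Rightarrow> nat \<Rightarrow> 'u" where
  "numv N k = (succS N ^^ k) (zeroS N)"

lemma eval_num [simp]: "eval N \<rho> (num k) = numv N k"
  by (induction k) (simp_all add: numv_def)

lemma numv_0: "numv N 0 = zeroS N" and numv_Suc: "succS N (numv N k) = numv N (Suc k)"
  by (simp_all add: numv_def)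

lemma model_holds: "model L T N \<Longrightarrow> prv L T A \<Longrightarrow> range \<rho> \<subseteq> carr N \<Longrightarrow> holds N \<rho> A"
  by (simp add: model_def)

lemma numv_carr: assumes "model L T N" shows "numv N k \<in> carr N"
proof -
  obtain a where "a \<in> carr N" using assms by (auto simp: model_def)
  then have "range (\<lambda>_ :: nat. a) \<subseteq> carr N" by auto
  then have "eval N (\<lambda>_. a) (num k) \<in> carr N"
    using assms wf_num[of L k] unfolding model_def by blast
  then show ?thesis by simp
qed

section \<open>The interpreted numbers inside a model\<close>

fun arith_tm :: "tm \<Rightarrow> bool" where
  "arith_tm (Var n) = True"
| "arith_tm Zero = True"
| "arith_tm (Succ t) = arith_tm t"
| "arith_tm (Plus s t) = (arith_tm s \<and> arith_tm t)"
| "arith_tm (Times s t) = (arith_tm s \<and> arith_tm t)"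
| "arith_tm (Fn f ts) = False"

fun arith_fm :: "fm \<Rightarrow> bool" where
  "arith_fm Fls = True"
| "arith_fm (Eq s t) = (arith_tm s \<and> arith_tm t)"
| "arith_fm (Rel r ts) = False"
| "arith_fm (Imp A B) = (arith_fm A \<and> arith_fm B)"
| "arith_fm (All A) = arith_fm A"

definition number :: "interp \<Rightarrow> 'u struc \<Rightarrow> 'u \<Rightarrow> bool" where
  "number I N a \<longleftrightarrow> a \<in> carr N \<and> pred N (dom I) [a]"

definition graph_value :: "interp \<Rightarrow> 'u struc \<Rightarrow> fm \<Rightarrow> 'u list \<Rightarrow> 'u" where
  "graph_value I N A as = (SOME c. number I N c \<and> (\<forall>z. number I N z \<longrightarrow> (pred N A (as @ [z]) \<longleftrightarrow> z = c)))"

text \<open>The structure that the interpretation defines in \<open>N\<close>. Zero is the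
  denotation of the numeral rather than a chosen element, which \<open>zero_graph\<close> justifies;
  the other symbols get dummy values, as only arithmetical formulas are evaluated here.\<close>

definition numbers :: "interp \<Rightarrow> 'u struc \<Rightarrow> 'u struc" where
  "numbers I N = \<lparr>carr = {a. number I N a}, zeroS = numv N 0,
     succS = (\<lambda>a. graph_value I N (succ_gr I) [a]),
     plusS = (\<lambda>a b. graph_value I N (plus_gr I) [a, b]),
     timesS = (\<lambda>a b. graph_value I N (times_gr I) [a, b]),
     funS = \<lambda>f as. numv N 0, relS = \<lambda>r as. False\<rparr>"

locale Q_model =
  fixes L :: lang and T :: "fm set" and I :: interp and N :: "'u struc"
  assumes interp: "interpretation_of_Q L T I" and agree: "numerals_agree L T I"
    and model: "model L T N"
begin

abbreviation isnum :: "'u \<Rightarrow> bool" where "isnum \<equiv> number I N"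
abbreviation std :: "nat \<Rightarrow> 'u" where "std \<equiv> numv N"
abbreviation sc :: "'u \<Rightarrow> 'u" where "sc \<equiv> succS (numbers I N)"
abbreviation add :: "'u \<Rightarrow> 'u \<Rightarrow> 'u" where "add \<equiv> plusS (numbers I N)"
abbreviation mul :: "'u \<Rightarrow> 'u \<Rightarrow> 'u" where "mul \<equiv> timesS (numbers I N)"

lemma formulas:
  "formula L 1 (dom I)" "formula L 1 (zero_gr I)" "formula L 2 (succ_gr I)"
  "formula L 3 (plus_gr I)" "formula L 3 (times_gr I)"
  using interp by (simp_all add: interpretation_of_Q_def)

lemmas holds_formulas = formulas[THEN holds_app]

lemma numbers_simps: "carr (numbers I N) = {a. isnum a}" "zeroS (numbers I N) = std 0"
  by (simp_all add: numbers_def)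

lemma range_std: "range (\<lambda>_ :: nat. std 0) \<subseteq> carr N"
  using numv_carr[OF model] by auto

lemmas theorem_holds = model_holds[OF model _ range_std]

lemma isnum_std: "isnum (std k)"
proof -
  have "prv L T (app (dom I) [num k])" using agree by (simp add: numerals_agree_def)
  from theorem_holds[OF this] show ?thesis
    using numv_carr[OF model] by (simp add: number_def holds_formulas)
qed

lemma holds_AllD:
  "holds N \<rho> (AllD I A) \<longleftrightarrow> (\<forall>a. isnum a \<longrightarrow> holds N (case_nat a \<rho>) A)"
  by (auto simp: number_def holds_formulas)

lemma holds_ExD:
  "holds N \<rho> (ExD I A) \<longleftrightarrow> (\<exists>a. isnum a \<and> holds N (case_nat a \<rho>) A)"
  by (auto simp: number_def holds_formulas)

lemma graph_value:
  assumes "\<exists>c. isnum c \<and> (\<forall>z. isnum z \<longrightarrow> (pred N A (as @ [z]) \<longleftrightarrow> z = c))"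
  shows "isnum (graph_value I N A as)"
    and "isnum z \<Longrightarrow> pred N A (as @ [z]) \<longleftrightarrow> z = graph_value I N A as"
  using someI_ex[OF assms] unfolding graph_value_def by blast+

lemma zero_graph: assumes "isnum z" shows "pred N (zero_gr I) [z] \<longleftrightarrow> z = std 0"
proof -
  have "prv L T (ExD I (AllD I (Iff (app (zero_gr I) [Var 0]) (Eq (Var 0) (Var 1)))))"
    using interp by (simp add: interpretation_of_Q_def)
  from theorem_holds[OF this] have "\<exists>c. isnum c \<and> (\<forall>z. isnum z \<longrightarrow> (pred N (zero_gr I) [z] \<longleftrightarrow> z = c))"
    unfolding holds_ExD holds_AllD holds_Iff by (simp add: holds_formulas)
  then obtain c where c: "\<And>z. isnum z \<Longrightarrow> pred N (zero_gr I) [z] \<longleftrightarrow> z = c" by blast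
  have "prv L T (app (zero_gr I) [num 0])" using agree by (simp add: numerals_agree_def)
  from theorem_holds[OF this] have "pred N (zero_gr I) [std 0]" by (simp add: holds_formulas numv_0)
  then show ?thesis using c isnum_std assms by blast
qed

lemma succ_graph:
  assumes "isnum a"
  shows "isnum (sc a)" and "isnum z \<Longrightarrow> pred N (succ_gr I) [a, z] \<longleftrightarrow> z = sc a"
proof -
  have "prv L T (AllD I (ExD I (AllD I (Iff (app (succ_gr I) [Var 2, Var 0]) (Eq (Var 0) (Var 1))))))"
    using interp by (simp add: interpretation_of_Q_def)
  from theorem_holds[OF this] have
    "\<forall>a. isnum a \<longrightarrow> (\<exists>c. isnum c \<and> (\<forall>z. isnum z \<longrightarrow> (pred N (succ_gr I) [a, z] \<longleftrightarrow> z = c)))"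
    unfolding holds_ExD holds_AllD holds_Iff by (simp add: holds_formulas numeral_2_eq_2)
  with assms have "\<exists>c. isnum c \<and> (\<forall>z. isnum z \<longrightarrow> (pred N (succ_gr I) ([a] @ [z]) \<longleftrightarrow> z = c))"
    by simp
  from graph_value[OF this] show "isnum (sc a)" "isnum z \<Longrightarrow> pred N (succ_gr I) [a, z] \<longleftrightarrow> z = sc a"
    by (simp_all add: numbers_def)
qed

lemma plus_graph:
  assumes "isnum a" "isnum b"
  shows "isnum (add a b)" and "isnum z \<Longrightarrow> pred N (plus_gr I) [a, b, z] \<longleftrightarrow> z = add a b"
proof -
  have "prv L T (AllD I (AllD I (ExD I (AllD I
       (Iff (app (plus_gr I) [Var 3, Var 2, Var 0]) (Eq (Var 0) (Var 1)))))))"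
    using interp by (simp add: interpretation_of_Q_def)
  from theorem_holds[OF this] have
    "\<forall>a. isnum a \<longrightarrow> (\<forall>b. isnum b \<longrightarrow> (\<exists>c. isnum c \<and> (\<forall>z. isnum z \<longrightarrow> (pred N (plus_gr I) [a, b, z] \<longleftrightarrow> z = c))))"
    unfolding holds_ExD holds_AllD holds_Iff by (simp add: holds_formulas numeral_2_eq_2 numeral_3_eq_3)
  with assms have "\<exists>c. isnum c \<and> (\<forall>z. isnum z \<longrightarrow> (pred N (plus_gr I) ([a, b] @ [z]) \<longleftrightarrow> z = c))"
    by simp
  from graph_value[OF this]
  show "isnum (add a b)" "isnum z \<Longrightarrow> pred N (plus_gr I) [a, b, z] \<longleftrightarrow> z = add a b"
    by (simp_all add: numbers_def)
qed

lemma times_graph: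
  assumes "isnum a" "isnum b"
  shows "isnum (mul a b)" and "isnum z \<Longrightarrow> pred N (times_gr I) [a, b, z] \<longleftrightarrow> z = mul a b"
proof -
  have "prv L T (AllD I (AllD I (ExD I (AllD I
       (Iff (app (times_gr I) [Var 3, Var 2, Var 0]) (Eq (Var 0) (Var 1)))))))"
    using interp by (simp add: interpretation_of_Q_def)
  from theorem_holds[OF this] have
    "\<forall>a. isnum a \<longrightarrow> (\<forall>b. isnum b \<longrightarrow> (\<exists>c. isnum c \<and> (\<forall>z. isnum z \<longrightarrow> (pred N (times_gr I) [a, b, z] \<longleftrightarrow> z = c))))"
    unfolding holds_ExD holds_AllD holds_Iff by (simp add: holds_formulas numeral_2_eq_2 numeral_3_eq_3)
  with assms have "\<exists>c. isnum c \<and> (\<forall>z. isnum z \<longrightarrow> (pred N (times_gr I) ([a, b] @ [z]) \<longleftrightarrow> z = c))"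
    by simp
  from graph_value[OF this]
  show "isnum (mul a b)" "isnum z \<Longrightarrow> pred N (times_gr I) [a, b, z] \<longleftrightarrow> z = mul a b"
    by (simp_all add: numbers_def)
qed

text \<open>The witnesses of \<open>ExD\<close> can only be the values of the subterms. The
  auxiliary equations on valuations express that the substitutions inside \<open>value_is\<close>
  skip the newly bound variables.\<close>

lemma value_is:
  assumes "arith_tm t" "\<And>n. n \<in> fv_tm t \<Longrightarrow> isnum (\<rho> n)"
  shows "isnum (eval (numbers I N) \<rho> t) \<and>
    (\<forall>b. isnum b \<longrightarrow> (holds N (case_nat b \<rho>) (value_is I t) \<longleftrightarrow> b = eval (numbers I N) \<rho> t))"
  using assms
proof (induction t)
  case (Var n)
  then show ?case by simp
next
  case Zero
  then show ?case by (simp add: numbers_simps isnum_std holds_formulas zero_graph del: holds.simps)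
next
  case (Succ t)
  have *: "(\<lambda>n. eval N (case_nat a (case_nat b \<rho>)) (case_nat (Var 0) (\<lambda>n. Var (Suc (Suc n))) n)) = case_nat a \<rho>" for a b
    by (rule ext) (simp split: nat.split)
  from Succ have IH: "isnum (eval (numbers I N) \<rho> t)"
    "\<And>a. isnum a \<Longrightarrow> holds N (case_nat a \<rho>) (value_is I t) \<longleftrightarrow> a = eval (numbers I N) \<rho> t" by auto
  have "holds N (case_nat b \<rho>) (value_is I (Succ t)) \<longleftrightarrow> b = sc (eval (numbers I N) \<rho> t)" if "isnum b" for b
  proof -
    have "holds N (case_nat b \<rho>) (value_is I (Succ t)) \<longleftrightarrow>
      (\<exists>a. isnum a \<and> a = eval (numbers I N) \<rho> t \<and> pred N (succ_gr I) [a, b])"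
      unfolding value_is.simps holds_ExD
      by (rule ex_cong1) (auto simp: holds_subst * IH holds_formulas)
    then show ?thesis using IH(1) succ_graph that by auto
  qed
  then show ?case using succ_graph IH by simp
next
  case (Plus s t)
  have *: "(\<lambda>n. eval N (case_nat c (case_nat a (case_nat b \<rho>))) (case_nat (Var (Suc 0)) (\<lambda>n. Var (n + 3)) n)) = case_nat a \<rho>"
    "(\<lambda>n. eval N (case_nat c (case_nat a (case_nat b \<rho>))) (case_nat (Var 0) (\<lambda>n. Var (n + 3)) n)) = case_nat c \<rho>" for a b c
    by (rule ext, simp add: numeral_3_eq_3 split: nat.split)+
  from Plus have IH: "isnum (eval (numbers I N) \<rho> s)" "isnum (eval (numbers I N) \<rho> t)"
    "\<And>a. isnum a \<Longrightarrow> holds N (case_nat a \<rho>) (value_is I s) \<longleftrightarrow> a = eval (numbers I N) \<rho> s"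
    "\<And>a. isnum a \<Longrightarrow> holds N (case_nat a \<rho>) (value_is I t) \<longleftrightarrow> a = eval (numbers I N) \<rho> t" by auto
  have "holds N (case_nat b \<rho>) (value_is I (Plus s t)) \<longleftrightarrow>
    b = add (eval (numbers I N) \<rho> s) (eval (numbers I N) \<rho> t)" if "isnum b" for b
  proof -
    have "holds N (case_nat b \<rho>) (value_is I (Plus s t)) \<longleftrightarrow>
      (\<exists>a. isnum a \<and> (\<exists>c. isnum c \<and> a = eval (numbers I N) \<rho> s \<and> c = eval (numbers I N) \<rho> t \<and>
        pred N (plus_gr I) [a, c, b]))"
      unfolding value_is.simps holds_ExD
      by (intro ex_cong1 conj_cong refl) (auto simp: holds_subst * IH holds_formulas numeral_2_eq_2)
    then show ?thesis using IH(1,2) plus_graph that by auto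
  qed
  then show ?case using plus_graph IH by simp
next
  case (Times s t)
  have *: "(\<lambda>n. eval N (case_nat c (case_nat a (case_nat b \<rho>))) (case_nat (Var (Suc 0)) (\<lambda>n. Var (n + 3)) n)) = case_nat a \<rho>"
    "(\<lambda>n. eval N (case_nat c (case_nat a (case_nat b \<rho>))) (case_nat (Var 0) (\<lambda>n. Var (n + 3)) n)) = case_nat c \<rho>" for a b c
    by (rule ext, simp add: numeral_3_eq_3 split: nat.split)+
  from Times have IH: "isnum (eval (numbers I N) \<rho> s)" "isnum (eval (numbers I N) \<rho> t)"
    "\<And>a. isnum a \<Longrightarrow> holds N (case_nat a \<rho>) (value_is I s) \<longleftrightarrow> a = eval (numbers I N) \<rho> s"
    "\<And>a. isnum a \<Longrightarrow> holds N (case_nat a \<rho>) (value_is I t) \<longleftrightarrow> a = eval (numbers I N) \<rho> t" by auto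
  have "holds N (case_nat b \<rho>) (value_is I (Times s t)) \<longleftrightarrow>
    b = mul (eval (numbers I N) \<rho> s) (eval (numbers I N) \<rho> t)" if "isnum b" for b
  proof -
    have "holds N (case_nat b \<rho>) (value_is I (Times s t)) \<longleftrightarrow>
      (\<exists>a. isnum a \<and> (\<exists>c. isnum c \<and> a = eval (numbers I N) \<rho> s \<and> c = eval (numbers I N) \<rho> t \<and>
        pred N (times_gr I) [a, c, b]))"
      unfolding value_is.simps holds_ExD
      by (intro ex_cong1 conj_cong refl) (auto simp: holds_subst * IH holds_formulas numeral_2_eq_2)
    then show ?thesis using IH(1,2) times_graph that by auto
  qed
  then show ?case using times_graph IH by simp
next
  case (Fn f ts)
  then show ?case by simp
qed

text \<open>Turns provability of a translated axiom into truth in \<open>numbers I N\<close>. Free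
  variables must denote numbers, because \<open>translate\<close> relativizes the bound ones
  only.\<close>

lemma holds_translate:
  assumes "arith_fm A" "\<And>n. n \<in> fv A \<Longrightarrow> isnum (\<rho> n)"
  shows "holds N \<rho> (translate I A) \<longleftrightarrow> holds (numbers I N) \<rho> A"
  using assms
proof (induction A arbitrary: \<rho>)
  case (Eq s t)
  have s: "isnum (eval (numbers I N) \<rho> s)"
    "\<And>a. isnum a \<Longrightarrow> holds N (case_nat a \<rho>) (value_is I s) \<longleftrightarrow> a = eval (numbers I N) \<rho> s"
    using value_is[of s \<rho>] Eq.prems by auto
  have t: "isnum (eval (numbers I N) \<rho> t)"
    "\<And>a. isnum a \<Longrightarrow> holds N (case_nat a \<rho>) (value_is I t) \<longleftrightarrow> a = eval (numbers I N) \<rho> t"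
    using value_is[of t \<rho>] Eq.prems by auto
  have "holds N \<rho> (translate I (Eq s t)) \<longleftrightarrow>
    (\<exists>a. isnum a \<and> a = eval (numbers I N) \<rho> s \<and> a = eval (numbers I N) \<rho> t)"
    unfolding translate.simps holds_ExD by (rule ex_cong1) (auto simp: s t)
  then show ?case using s(1) by auto
next
  case (Imp A B)
  from Imp.IH[of \<rho>] Imp.prems show ?case by simp
next
  case (All A)
  have "holds N (case_nat a \<rho>) (translate I A) \<longleftrightarrow> holds (numbers I N) (case_nat a \<rho>) A" if "isnum a" for a
    by (rule All.IH) (use All.prems that in \<open>auto split: nat.splits\<close>)
  then show ?case unfolding translate.simps holds_AllD by (simp add: numbers_simps)
qed simp_all

lemma robinson:
  assumes "A \<in> robinson_Q"
  shows "holds (numbers I N) \<rho> A"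
proof -
  have A: "arith_fm A" "fv A = {}" using assms by (auto simp: robinson_Q_def)
  have "prv L T (translate I A)" using assms interp by (simp add: interpretation_of_Q_def)
  from theorem_holds[OF this] have "holds (numbers I N) (\<lambda>_. std 0) A"
    using holds_translate[of A "\<lambda>_. std 0"] A by simp
  then show ?thesis using holds_cong[of A \<rho> "\<lambda>_. std 0"] A by simp
qed

lemma Q:
  "isnum a \<Longrightarrow> isnum b \<Longrightarrow> sc a = sc b \<Longrightarrow> a = b"
  "isnum a \<Longrightarrow> sc a \<noteq> std 0"
  "isnum a \<Longrightarrow> a \<noteq> std 0 \<Longrightarrow> \<exists>b. isnum b \<and> a = sc b"
  "isnum a \<Longrightarrow> add a (std 0) = a"
  "isnum a \<Longrightarrow> isnum b \<Longrightarrow> add a (sc b) = sc (add a b)"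
  "isnum a \<Longrightarrow> mul a (std 0) = std 0"
  "isnum a \<Longrightarrow> isnum b \<Longrightarrow> mul a (sc b) = add (mul a b) a"
proof -
  have *: "holds (numbers I N) (\<lambda>_. std 0) A" if "A \<in> robinson_Q" for A
    using robinson that .
  note Q = *[unfolded robinson_Q_def]
  show "isnum a \<Longrightarrow> isnum b \<Longrightarrow> sc a = sc b \<Longrightarrow> a = b"
    using Q[of "All (All (Imp (Eq (Succ (Var 1)) (Succ (Var 0))) (Eq (Var 1) (Var 0))))"]
    by (simp add: numbers_simps)
  show "isnum a \<Longrightarrow> sc a \<noteq> std 0"
    using Q[of "All (Neg (Eq (Succ (Var 0)) Zero))"] by (simp add: numbers_simps)
  show "isnum a \<Longrightarrow> a \<noteq> std 0 \<Longrightarrow> \<exists>b. isnum b \<and> a = sc b"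
    using Q[of "All (Imp (Neg (Eq (Var 0) Zero)) (Ex (Eq (Var 1) (Succ (Var 0)))))"]
    by (auto simp: numbers_simps)
  show "isnum a \<Longrightarrow> add a (std 0) = a"
    using Q[of "All (Eq (Plus (Var 0) Zero) (Var 0))"] by (simp add: numbers_simps)
  show "isnum a \<Longrightarrow> isnum b \<Longrightarrow> add a (sc b) = sc (add a b)"
    using Q[of "All (All (Eq (Plus (Var 1) (Succ (Var 0))) (Succ (Plus (Var 1) (Var 0)))))"]
    by (simp add: numbers_simps)
  show "isnum a \<Longrightarrow> mul a (std 0) = std 0"
    using Q[of "All (Eq (Times (Var 0) Zero) Zero)"] by (simp add: numbers_simps)
  show "isnum a \<Longrightarrow> isnum b \<Longrightarrow> mul a (sc b) = add (mul a b) a"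
    using Q[of "All (All (Eq (Times (Var 1) (Succ (Var 0))) (Plus (Times (Var 1) (Var 0)) (Var 1))))"]
    by (simp add: numbers_simps)
qed

end

section \<open>Standard numbers and their summands\<close>

context Q_model
begin

text \<open>Here the agreement of numerals enters: on standard numbers the interpreted successor
  follows the symbol \<open>Succ\<close>, whatever it does elsewhere.\<close>

lemma sc_std: "sc (std k) = std (Suc k)"
proof -
  have "prv L T (app (succ_gr I) [num k, num (Suc k)])" using agree by (simp add: numerals_agree_def)
  from theorem_holds[OF this] have "pred N (succ_gr I) [std k, std (Suc k)]"
    by (simp add: holds_formulas numv_Suc del: num.simps)
  then show ?thesis using succ_graph(2)[OF isnum_std isnum_std, of k "Suc k"] by simp
qed

lemma add_std: "add (std m) (std n) = std (m + n)"
  by (induction n) (simp_all add: Q isnum_std flip: sc_std)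

lemma mul_std: "mul (std m) (std n) = std (m * n)"
  by (induction n) (simp_all add: Q isnum_std add_std add.commute flip: sc_std)

lemma sc_eq_std: "isnum a \<Longrightarrow> sc a = std k \<Longrightarrow> \<exists>j. k = Suc j \<and> a = std j"
  using Q(1)[OF _ isnum_std] Q(2) by (cases k) (auto simp flip: sc_std)

lemma std_eq_iff: "std m = std n \<longleftrightarrow> m = n"
proof (induction m arbitrary: n)
  case 0
  show ?case using Q(2)[OF isnum_std, THEN not_sym] by (cases n) (auto simp flip: sc_std)
next
  case (Suc m)
  then show ?case using sc_eq_std[OF isnum_std, of m n] by (auto simp flip: sc_std)
qed

text \<open>Robinson arithmetic has no induction, so the induction is on the standard value: a
  nonzero second summand is a successor, and cancelling this successor lowers the sum by
  one.\<close>

lemma add_eq_std: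
  "isnum a \<Longrightarrow> isnum b \<Longrightarrow> add a b = std k \<Longrightarrow> \<exists>i j. a = std i \<and> b = std j \<and> k = i + j"
proof (induction k arbitrary: b)
  case 0
  have "b = std 0"
  proof (rule ccontr)
    assume "b \<noteq> std 0"
    then obtain c where "isnum c" "b = sc c" using Q(3) 0 by blast
    then have "sc (add a c) = std 0" using 0 by (simp add: Q)
    then show False using Q(2) plus_graph(1) 0 \<open>isnum c\<close> by blast
  qed
  then show ?case using 0 by (auto simp: Q)
next
  case (Suc k)
  show ?case
  proof (cases "b = std 0")
    case True
    then show ?thesis using Suc.prems by (intro exI[of _ "Suc k"] exI[of _ 0]) (simp add: Q)
  next
    case False
    then obtain c where c: "isnum c" "b = sc c" using Q(3) Suc.prems by blast
    then have "sc (add a c) = std (Suc k)" using Suc.prems by (simp add: Q)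
    then have "add a c = std k" using sc_eq_std[OF plus_graph(1)] Suc.prems c by blast
    from Suc.IH[OF Suc.prems(1) c(1) this] obtain i j where "a = std i" "c = std j" "k = i + j" by blast
    then show ?thesis using c by (intro exI[of _ i] exI[of _ "Suc j"]) (simp add: sc_std)
  qed
qed

end

text \<open>\<open>Var 0\<close> is the head, \<open>Var 1\<close> the tail and \<open>Var 2\<close>
  the code of the list. Membership in the domain is demanded separately, since translating an
  equation does not relativize its free variables. Doubling clears the division by 2 in the
  triangular number of the pairing function.\<close>

definition cons_fm :: "interp \<Rightarrow> fm" where
  "cons_fm I = And (app (dom I) [Var 0]) (And (app (dom I) [Var 1]) (And (app (dom I) [Var 2])
     (translate I (Eq (Plus (Var 2) (Var 2))
       (Succ (Succ (Plus (Times (Plus (Var 0) (Var 1)) (Succ (Plus (Var 0) (Var 1))))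
         (Plus (Var 0) (Var 0)))))))))"

context Q_model
begin

text \<open>Twice the equation \<open>z = Suc (prod_encode (a, l))\<close>, which says that \<open>z\<close> codes a list with
  head \<open>a\<close> and tail coded by \<open>l\<close>.\<close>

definition cons_eq :: "'u \<Rightarrow> 'u \<Rightarrow> 'u \<Rightarrow> bool" where
  "cons_eq a l z \<longleftrightarrow> add z z = sc (sc (add (mul (add a l) (sc (add a l))) (add a a)))"

lemma cons_eq_std: "cons_eq (std i) (std j) (std k) \<longleftrightarrow> k = Suc (prod_encode (i, j))"
proof -
  have "even ((i + j) * Suc (i + j))" by simp
  then have "2 * triangle (i + j) = (i + j) * Suc (i + j)" by (simp add: triangle_def)
  then have "k + k = Suc (Suc ((i + j) * Suc (i + j) + (i + i))) \<longleftrightarrow> k = Suc (prod_encode (i, j))"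
    unfolding prod_encode_def by auto
  then show ?thesis by (simp add: cons_eq_def add_std mul_std sc_std std_eq_iff del: mult_Suc_right)
qed

text \<open>Head and tail are standard, hence so is the right side, and \<open>z\<close> is a
  summand of it.\<close>

lemma cons_eq_forward:
  assumes "isnum z"
  shows "cons_eq (std i) (std j) z \<longleftrightarrow> z = std (Suc (prod_encode (i, j)))"
proof
  assume eq: "cons_eq (std i) (std j) z"
  then obtain k where "z = std k"
    using add_eq_std[OF assms assms] by (auto simp: cons_eq_def add_std mul_std sc_std)
  with eq show "z = std (Suc (prod_encode (i, j)))" by (simp add: cons_eq_std)
qed (simp add: cons_eq_std)

text \<open>Only the code is known to be standard. \<open>a\<close> and \<open>l\<close> are reached
  by stripping successors and descending to summands of standard sums.\<close>

lemma cons_eq_backward: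
  assumes "isnum a" "isnum l"
  shows "cons_eq a l (std (Suc (prod_encode (i, j)))) \<longleftrightarrow> a = std i \<and> l = std j"
proof
  let ?k = "Suc (prod_encode (i, j))"
  assume eq: "cons_eq a l (std ?k)"
  note num = plus_graph(1) succ_graph(1) times_graph(1)
  have al: "isnum (add a l)" using assms num by blast
  have "isnum (add (mul (add a l) (sc (add a l))) (add a a))"
    using assms by (intro num)
  moreover from this have "isnum (sc (add (mul (add a l) (sc (add a l))) (add a a)))" by (rule num)
  ultimately obtain n where "add (mul (add a l) (sc (add a l))) (add a a) = std n"
    using eq sc_eq_std unfolding cons_eq_def add_std by metis
  then obtain n' where "mul (add a l) (sc (add a l)) = std n'"
    using add_eq_std[of "mul (add a l) (sc (add a l))" "add a a" n] assms num by blast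
  \<comment> \<open>A factor of a standard product may be nonstandard if the other one is zero. But
    the second factor is a successor, so the product unfolds to a sum with \<open>add a l\<close> as
    a summand.\<close>
  then have "add (mul (add a l) (add a l)) (add a l) = std n'"
    using al by (simp add: Q)
  then obtain n'' where "add a l = std n''"
    using add_eq_std[OF num(3)[OF al al] al] by blast
  then obtain i' j' where "a = std i'" "l = std j'"
    using add_eq_std[OF assms] by blast
  moreover from this eq have "prod_encode (i, j) = prod_encode (i', j')"
    by (simp add: cons_eq_std)
  then have "(i, j) = (i', j')" by (simp only: prod_encode_eq)
  ultimately show "a = std i \<and> l = std j" by simp
qed (simp add: cons_eq_std)

lemma pred_cons_fm:
  assumes "a \<in> carr N" "l \<in> carr N" "z \<in> carr N"
  shows "pred N (cons_fm I) [a, l, z] \<longleftrightarrow> isnum a \<and> isnum l \<and> isnum z \<and> cons_eq a l z"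
proof -
  let ?E = "Eq (Plus (Var 2) (Var 2)) (Succ (Succ (Plus (Times (Plus (Var 0) (Var 1)) (Succ (Plus (Var 0) (Var 1))))
         (Plus (Var 0) (Var 0)))))"
  have "pred N (cons_fm I) [a, l, z] \<longleftrightarrow> isnum a \<and> isnum l \<and> isnum z \<and>
    holds N (\<lambda>n. [a, l, z] ! n) (translate I ?E)"
    unfolding cons_fm_def pred_def[of N "And _ _"] using assms
    by (auto simp: holds_formulas number_def numeral_2_eq_2 simp del: translate.simps)
  also have "\<dots> \<longleftrightarrow> isnum a \<and> isnum l \<and> isnum z \<and> holds (numbers I N) (\<lambda>n. [a, l, z] ! n) ?E"
    by (intro conj_cong refl holds_translate) (auto simp: numeral_2_eq_2)
  also have "\<dots> \<longleftrightarrow> isnum a \<and> isnum l \<and> isnum z \<and> cons_eq a l z"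
    by (simp add: cons_eq_def numeral_2_eq_2)
  finally show ?thesis .
qed

end


section \<open>Representable functions\<close>

lemma formula_mono: "formula L k A \<Longrightarrow> k \<le> j \<Longrightarrow> formula L j A"
  by (auto simp: formula_def)

lemma formula_Eq: "wf_tm L s \<Longrightarrow> wf_tm L t \<Longrightarrow> fv_tm s \<subseteq> {..<k} \<Longrightarrow> fv_tm t \<subseteq> {..<k} \<Longrightarrow> formula L k (Eq s t)"
  by (simp add: formula_def)

lemma formula_Imp: "formula L k A \<Longrightarrow> formula L k B \<Longrightarrow> formula L k (Imp A B)"
  by (simp add: formula_def)

lemma formula_Fls: "formula L k Fls"
  by (simp add: formula_def)

lemma formula_All: "formula L (Suc k) A \<Longrightarrow> formula L k (All A)"
  by (auto simp: formula_def)

lemmas formula_intros = formula_Fls formula_Imp formula_All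

lemma formula_subst:
  assumes "wf_fm L A" "\<And>n. wf_tm L (\<sigma> n)" "\<And>n. n \<in> fv A \<Longrightarrow> fv_tm (\<sigma> n) \<subseteq> {..<k}"
  shows "formula L k (subst \<sigma> A)"
  unfolding formula_def using assms by (auto simp: wf_subst fv_subst)

lemma formula_app:
  assumes "formula L j A" "length ts = j" "\<And>t. t \<in> set ts \<Longrightarrow> wf_tm L t \<and> fv_tm t \<subseteq> {..<k}"
  shows "formula L k (app A ts)"
  using assms fv_app[of L ts A] wf_app[of L A ts] unfolding formula_def by blast

context
  fixes L T I assumes interp: "interpretation_of_Q L T I"
begin

lemma interp_formulas:
  "formula L 1 (dom I)" "formula L 1 (zero_gr I)" "formula L 2 (succ_gr I)"
  "formula L 3 (plus_gr I)" "formula L 3 (times_gr I)"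
  using interp by (simp_all add: interpretation_of_Q_def)

lemmas interp_app = interp_formulas[THEN formula_app]

lemma formula_value_is:
  "arith_tm t \<Longrightarrow> fv_tm t \<subseteq> {..<k} \<Longrightarrow> formula L (Suc k) (value_is I t)"
proof (induction t)
  case (Var n)
  then show ?case by (auto intro!: formula_Eq)
next
  case Zero
  then show ?case by (auto intro!: interp_app)
next
  case (Succ t)
  then have t: "wf_fm L (value_is I t)" "fv (value_is I t) \<subseteq> {..<Suc k}" by (auto simp: formula_def)
  then have "formula L (Suc (Suc k)) (subst (case_nat (Var 0) (\<lambda>n. Var (n + 2))) (value_is I t))"
    by (intro formula_subst) (auto split: nat.splits)
  then show ?case by (auto intro!: formula_intros interp_app)
next
  case (Plus s t)
  then have st: "wf_fm L (value_is I s)" "fv (value_is I s) \<subseteq> {..<Suc k}"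
    "wf_fm L (value_is I t)" "fv (value_is I t) \<subseteq> {..<Suc k}" by (auto simp: formula_def)
  then have "formula L (Suc (Suc (Suc k))) (subst (case_nat (Var 1) (\<lambda>n. Var (n + 3))) (value_is I s))"
    "formula L (Suc (Suc (Suc k))) (subst (case_nat (Var 0) (\<lambda>n. Var (n + 3))) (value_is I t))"
    by (intro formula_subst; auto split: nat.splits)+
  then show ?case by (auto intro!: formula_intros interp_app)
next
  case (Times s t)
  then have st: "wf_fm L (value_is I s)" "fv (value_is I s) \<subseteq> {..<Suc k}"
    "wf_fm L (value_is I t)" "fv (value_is I t) \<subseteq> {..<Suc k}" by (auto simp: formula_def)
  then have "formula L (Suc (Suc (Suc k))) (subst (case_nat (Var 1) (\<lambda>n. Var (n + 3))) (value_is I s))"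
    "formula L (Suc (Suc (Suc k))) (subst (case_nat (Var 0) (\<lambda>n. Var (n + 3))) (value_is I t))"
    by (intro formula_subst; auto split: nat.splits)+
  then show ?case by (auto intro!: formula_intros interp_app)
next
  case (Fn f ts)
  then show ?case by simp
qed

lemma formula_translate:
  "arith_fm A \<Longrightarrow> fv A \<subseteq> {..<k} \<Longrightarrow> formula L k (translate I A)"
proof (induction A arbitrary: k)
  case (All A)
  have "n < Suc k" if "n \<in> fv A" for n using All.prems that by (cases n) auto
  then have "formula L (Suc k) (translate I A)" using All by (intro All.IH) auto
  then show ?case by (auto intro!: formula_intros interp_app)
qed (auto intro!: formula_intros interp_app formula_value_is)

lemma formula_cons_fm: "formula L 3 (cons_fm I)"
  unfolding cons_fm_def by (auto intro!: formula_intros interp_app formula_translate simp del: translate.simps)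

end


text \<open>A function is given along a parametrization \<open>h\<close> of its domain, which can so consist of codes
  of a fixed shape only.\<close>

definition represents :: "lang \<Rightarrow> fm set \<Rightarrow> fm \<Rightarrow> (nat \<Rightarrow> nat) \<Rightarrow> (nat \<Rightarrow> nat) \<Rightarrow> bool" where
  "represents L T F h k \<longleftrightarrow> formula L 2 F \<and>
     (\<forall>N :: tm struc. model L T N \<longrightarrow>
        (\<forall>m. \<forall>b\<in>carr N. pred N F [numv N (h m), b] \<longleftrightarrow> b = numv N (k m)))"

definition representable :: "lang \<Rightarrow> fm set \<Rightarrow> (nat \<Rightarrow> nat) \<Rightarrow> (nat \<Rightarrow> nat) \<Rightarrow> bool" where
  "representable L T h k \<longleftrightarrow> (\<exists>F. represents L T F h k)"

lemma representable_id: "representable L T h h"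
  unfolding representable_def represents_def
  by (rule exI[of _ "Eq (Var 1) (Var 0)"]) (auto simp: formula_def pred_def)

lemma representable_const: "representable L T h (\<lambda>_. c)"
  unfolding representable_def represents_def
  by (rule exI[of _ "Eq (Var 1) (num c)"]) (auto simp: formula_def pred_def)

text \<open>The intermediate value ranges over the whole carrier, but the first formula pins it to
  the standard value of \<open>h m\<close>, where the behaviour of the second one is known.\<close>

lemma representable_comp:
  assumes "representable L T g h" "representable L T h k"
  shows "representable L T g k"
proof -
  obtain F G where FG: "represents L T F g h" "represents L T G h k"
    using assms by (auto simp: representable_def)
  then have F: "formula L 2 F" and G: "formula L 2 G" by (auto simp: represents_def)
  let ?H = "Ex (And (app F [Var 1, Var 0]) (app G [Var 0, Var 2]))"
  have "represents L T ?H g k"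
    unfolding represents_def
  proof (intro conjI allI impI ballI)
    show "formula L 2 ?H" by (auto intro!: formula_intros F[THEN formula_app] G[THEN formula_app])
    fix N :: "tm struc" and m b assume N: "model L T N" and b: "b \<in> carr N"
    have "pred N ?H [numv N (g m), b] \<longleftrightarrow>
      (\<exists>c\<in>carr N. pred N F [numv N (g m), c] \<and> pred N G [c, b])"
      unfolding pred_def[of N ?H] by (simp add: F[THEN holds_app] G[THEN holds_app] numeral_2_eq_2)
    also have "\<dots> \<longleftrightarrow> (\<exists>c\<in>carr N. c = numv N (h m) \<and> pred N G [c, b])"
      using FG(1) N by (auto simp: represents_def)
    also have "\<dots> \<longleftrightarrow> b = numv N (k m)"
      using FG(2) N b numv_carr[OF N] by (auto simp: represents_def)
    finally show "pred N ?H [numv N (g m), b] \<longleftrightarrow> b = numv N (k m)" .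
  qed
  then show ?thesis by (auto simp: representable_def)
qed

context
  fixes L T I assumes interp: "interpretation_of_Q L T I" and agree: "numerals_agree L T I"
begin

lemmas cons_fm = formula_cons_fm[OF interp]

text \<open>By \<open>cons_eq_backward\<close>, any two elements that satisfy \<open>cons_fm\<close>
  together with this code are the standard head and tail, nonstandard candidates being
  excluded.\<close>

lemma representable_head: "representable L T (\<lambda>m. Suc (prod_encode (x m, y m))) x"
proof -
  let ?H = "Ex (app (cons_fm I) [Var 2, Var 0, Var 1])"
  have "represents L T ?H (\<lambda>m. Suc (prod_encode (x m, y m))) x"
    unfolding represents_def
  proof (intro conjI allI impI ballI)
    show "formula L 2 ?H" by (auto intro!: formula_intros cons_fm[THEN formula_app])
    fix N :: "tm struc" and m b assume N: "model L T N" and b: "b \<in> carr N"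
    interpret Q_model L T I N using interp agree N by unfold_locales
    let ?z = "Suc (prod_encode (x m, y m))"
    have "pred N ?H [std ?z, b] \<longleftrightarrow> (\<exists>c\<in>carr N. pred N (cons_fm I) [b, c, std ?z])"
      unfolding pred_def[of N ?H] by (simp add: cons_fm[THEN holds_app] numeral_2_eq_2)
    also have "\<dots> \<longleftrightarrow> (\<exists>c\<in>carr N. isnum b \<and> isnum c \<and> b = std (x m) \<and> c = std (y m))"
      by (rule bex_cong[OF refl])
        (use b in \<open>auto simp: pred_cons_fm numv_carr[OF N] isnum_std cons_eq_backward cong: conj_cong\<close>)
    finally show "pred N ?H [std ?z, b] \<longleftrightarrow> b = std (x m)"
      using isnum_std numv_carr[OF N] by blast
  qed
  then show ?thesis by (auto simp: representable_def)
qed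

lemma representable_tail: "representable L T (\<lambda>m. Suc (prod_encode (x m, y m))) y"
proof -
  let ?H = "Ex (app (cons_fm I) [Var 0, Var 2, Var 1])"
  have "represents L T ?H (\<lambda>m. Suc (prod_encode (x m, y m))) y"
    unfolding represents_def
  proof (intro conjI allI impI ballI)
    show "formula L 2 ?H" by (auto intro!: formula_intros cons_fm[THEN formula_app])
    fix N :: "tm struc" and m b assume N: "model L T N" and b: "b \<in> carr N"
    interpret Q_model L T I N using interp agree N by unfold_locales
    let ?z = "Suc (prod_encode (x m, y m))"
    have "pred N ?H [std ?z, b] \<longleftrightarrow> (\<exists>c\<in>carr N. pred N (cons_fm I) [c, b, std ?z])"
      unfolding pred_def[of N ?H] by (simp add: cons_fm[THEN holds_app] numeral_2_eq_2)
    also have "\<dots> \<longleftrightarrow> (\<exists>c\<in>carr N. isnum b \<and> isnum c \<and> b = std (y m) \<and> c = std (x m))"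
      by (rule bex_cong[OF refl])
        (use b in \<open>auto simp: pred_cons_fm numv_carr[OF N] isnum_std cons_eq_backward cong: conj_cong\<close>)
    finally show "pred N ?H [std ?z, b] \<longleftrightarrow> b = std (y m)"
      using isnum_std numv_carr[OF N] by blast
  qed
  then show ?thesis by (auto simp: representable_def)
qed

lemma representable_Cons:
  assumes "representable L T h x" "representable L T h y"
  shows "representable L T h (\<lambda>m. Suc (prod_encode (x m, y m)))"
proof -
  obtain F G where FG: "represents L T F h x" "represents L T G h y"
    using assms by (auto simp: representable_def)
  then have F: "formula L 2 F" and G: "formula L 2 G" by (auto simp: represents_def)
  let ?H = "Ex (Ex (And (app F [Var 2, Var 1]) (And (app G [Var 2, Var 0])
    (app (cons_fm I) [Var 1, Var 0, Var 3]))))"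
  have "represents L T ?H h (\<lambda>m. Suc (prod_encode (x m, y m)))"
    unfolding represents_def
  proof (intro conjI allI impI ballI)
    show "formula L 2 ?H"
      by (auto intro!: formula_intros cons_fm[THEN formula_app] F[THEN formula_app] G[THEN formula_app])
    fix N :: "tm struc" and m b assume N: "model L T N" and b: "b \<in> carr N"
    interpret Q_model L T I N using interp agree N by unfold_locales
    have "pred N ?H [std (h m), b] \<longleftrightarrow> (\<exists>u\<in>carr N. \<exists>v\<in>carr N.
        pred N F [std (h m), u] \<and> pred N G [std (h m), v] \<and> pred N (cons_fm I) [u, v, b])"
      unfolding pred_def[of N ?H]
      by (simp add: cons_fm[THEN holds_app] F[THEN holds_app] G[THEN holds_app] numeral_2_eq_2 numeral_3_eq_3)
    also have "\<dots> \<longleftrightarrow> (\<exists>u\<in>carr N. \<exists>v\<in>carr N. u = std (x m) \<and> v = std (y m) \<and> pred N (cons_fm I) [u, v, b])"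
      using FG N by (auto simp: represents_def)
    also have "\<dots> \<longleftrightarrow> pred N (cons_fm I) [std (x m), std (y m), b]"
      using numv_carr[OF N] by blast
    also have "\<dots> \<longleftrightarrow> b = std (Suc (prod_encode (x m, y m)))"
      using b by (auto simp: pred_cons_fm numv_carr[OF N] isnum_std cons_eq_forward)
    finally show "pred N ?H [std (h m), b] \<longleftrightarrow> b = std (Suc (prod_encode (x m, y m)))" .
  qed
  then show ?thesis by (auto simp: representable_def)
qed

text \<open>The index is fixed outside the theory, so \<open>i\<close> tails and one head suffice;
  the lists may vary with \<open>m\<close> in entries and length.\<close>

lemma representable_nth:
  "(\<And>m. i < length (xs m)) \<Longrightarrow> representable L T (\<lambda>m. list_encode (xs m)) (\<lambda>m. xs m ! i)"
proof (induction i arbitrary: xs)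
  case (0 xs)
  have *: "xs m = hd (xs m) # tl (xs m)" for m using 0[of m] by (cases "xs m") auto
  have "list_encode (xs m) = Suc (prod_encode (hd (xs m), list_encode (tl (xs m))))" for m
    by (subst * ) simp
  moreover have "xs m ! 0 = hd (xs m)" for m using 0[of m] by (simp add: hd_conv_nth)
  ultimately show ?case by (simp add: representable_head)
next
  case (Suc i xs)
  have *: "xs m = hd (xs m) # tl (xs m)" for m using Suc.prems[of m] by (cases "xs m") auto
  have "list_encode (xs m) = Suc (prod_encode (hd (xs m), list_encode (tl (xs m))))" for m
    by (subst * ) simp
  then have "representable L T (\<lambda>m. list_encode (xs m)) (\<lambda>m. list_encode (tl (xs m)))"
    by (simp add: representable_tail)
  moreover have "representable L T (\<lambda>m. list_encode (tl (xs m))) (\<lambda>m. tl (xs m) ! i)"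
    using Suc.prems by (intro Suc.IH) (simp add: less_diff_conv)
  moreover have "tl (xs m) ! i = xs m ! Suc i" for m using Suc.prems[of m] by (simp add: nth_tl)
  ultimately show ?case using representable_comp by simp
qed

text \<open>The path from the root of \<open>t\<close> to an occurrence of \<open>Var j\<close> does
  not depend on \<open>m\<close>. Each of its steps selects a fixed entry of a list code, and the
  numeral sits at its end.\<close>

lemma representable_numeral_in_tm:
  assumes "j \<in> fv_tm t" "\<And>m. \<sigma> m j = num m"
  shows "representable L T (\<lambda>m. code_tm (subst_tm (\<sigma> m) t)) (\<lambda>m. code_tm (num m))"
  using assms(1)
proof (induction t)
  case (Var n)
  then show ?case using assms(2) by (simp add: representable_id)
next
  case Zero
  then show ?case by simp
next
  case (Succ t)
  have "representable L T (\<lambda>m. list_encode [2, code_tm (subst_tm (\<sigma> m) t)]) (\<lambda>m. code_tm (subst_tm (\<sigma> m) t))"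
    using representable_nth[of 1 "\<lambda>m. [2, code_tm (subst_tm (\<sigma> m) t)]"] by simp
  with Succ show ?case by (auto intro: representable_comp simp del: list_encode.simps)
next
  case (Plus s t)
  let ?xs = "\<lambda>m. [3, code_tm (subst_tm (\<sigma> m) s), code_tm (subst_tm (\<sigma> m) t)]"
  have "representable L T (\<lambda>m. list_encode (?xs m)) (\<lambda>m. code_tm (subst_tm (\<sigma> m) s))"
    "representable L T (\<lambda>m. list_encode (?xs m)) (\<lambda>m. code_tm (subst_tm (\<sigma> m) t))"
    using representable_nth[of 1 ?xs] representable_nth[of 2 ?xs] by (simp_all del: list_encode.simps)
  with Plus show ?case by (auto intro: representable_comp simp del: list_encode.simps)
next
  case (Times s t)
  let ?xs = "\<lambda>m. [4, code_tm (subst_tm (\<sigma> m) s), code_tm (subst_tm (\<sigma> m) t)]"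
  have "representable L T (\<lambda>m. list_encode (?xs m)) (\<lambda>m. code_tm (subst_tm (\<sigma> m) s))"
    "representable L T (\<lambda>m. list_encode (?xs m)) (\<lambda>m. code_tm (subst_tm (\<sigma> m) t))"
    using representable_nth[of 1 ?xs] representable_nth[of 2 ?xs] by (simp_all del: list_encode.simps)
  with Times show ?case by (auto intro: representable_comp simp del: list_encode.simps)
next
  case (Fn f ts)
  then obtain i where i: "i < length ts" "j \<in> fv_tm (ts ! i)" by (auto simp: in_set_conv_nth)
  let ?xs = "\<lambda>m. 5 # f # map code_tm (map (subst_tm (\<sigma> m)) ts)"
  have "representable L T (\<lambda>m. list_encode (?xs m)) (\<lambda>m. code_tm (subst_tm (\<sigma> m) (ts ! i)))"
    using representable_nth[of "Suc (Suc i)" ?xs] i by (simp del: list_encode.simps)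
  moreover have "representable L T (\<lambda>m. code_tm (subst_tm (\<sigma> m) (ts ! i))) (\<lambda>m. code_tm (num m))"
    using Fn.IH i by simp
  ultimately show ?case using representable_comp by (simp del: list_encode.simps)
qed

lemma representable_numeral_in_fm:
  assumes "j \<in> fv A" "\<And>m. \<sigma> m j = num m"
  shows "representable L T (\<lambda>m. code (subst (\<sigma> m) A)) (\<lambda>m. code_tm (num m))"
  using assms
proof (induction A arbitrary: j \<sigma>)
  case Fls
  then show ?case by simp
next
  case (Eq s t)
  let ?xs = "\<lambda>m. [1, code_tm (subst_tm (\<sigma> m) s), code_tm (subst_tm (\<sigma> m) t)]"
  have "representable L T (\<lambda>m. list_encode (?xs m)) (\<lambda>m. code_tm (subst_tm (\<sigma> m) s))"
    "representable L T (\<lambda>m. list_encode (?xs m)) (\<lambda>m. code_tm (subst_tm (\<sigma> m) t))"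
    using representable_nth[of 1 ?xs] representable_nth[of 2 ?xs] by (simp_all del: list_encode.simps)
  moreover have "representable L T (\<lambda>m. code_tm (subst_tm (\<sigma> m) s)) (\<lambda>m. code_tm (num m))" if "j \<in> fv_tm s"
    using that Eq.prems(2) by (rule representable_numeral_in_tm)
  moreover have "representable L T (\<lambda>m. code_tm (subst_tm (\<sigma> m) t)) (\<lambda>m. code_tm (num m))" if "j \<in> fv_tm t"
    using that Eq.prems(2) by (rule representable_numeral_in_tm)
  ultimately show ?case
    using Eq.prems(1) by (auto intro: representable_comp simp del: list_encode.simps)
next
  case (Rel r ts)
  then obtain i where i: "i < length ts" "j \<in> fv_tm (ts ! i)" by (auto simp: in_set_conv_nth)
  let ?xs = "\<lambda>m. 2 # r # map code_tm (map (subst_tm (\<sigma> m)) ts)"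
  have "representable L T (\<lambda>m. list_encode (?xs m)) (\<lambda>m. code_tm (subst_tm (\<sigma> m) (ts ! i)))"
    using representable_nth[of "Suc (Suc i)" ?xs] i by (simp del: list_encode.simps)
  moreover have "representable L T (\<lambda>m. code_tm (subst_tm (\<sigma> m) (ts ! i))) (\<lambda>m. code_tm (num m))"
    using i(2) Rel.prems(2) by (rule representable_numeral_in_tm)
  ultimately show ?case using representable_comp by (simp del: list_encode.simps)
next
  case (Imp A B)
  let ?xs = "\<lambda>m. [3, code (subst (\<sigma> m) A), code (subst (\<sigma> m) B)]"
  have "representable L T (\<lambda>m. list_encode (?xs m)) (\<lambda>m. code (subst (\<sigma> m) A))"
    "representable L T (\<lambda>m. list_encode (?xs m)) (\<lambda>m. code (subst (\<sigma> m) B))"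
    using representable_nth[of 1 ?xs] representable_nth[of 2 ?xs] by (simp_all del: list_encode.simps)
  with Imp.prems(1) Imp.IH[of j \<sigma>, OF _ Imp.prems(2)] show ?case
    by (auto intro: representable_comp simp del: list_encode.simps)
next
  case (All A)
  let ?xs = "\<lambda>m. [4, code (subst (under_binder (\<sigma> m)) A)]"
  have "representable L T (\<lambda>m. list_encode (?xs m)) (\<lambda>m. code (subst (under_binder (\<sigma> m)) A))"
    using representable_nth[of 1 ?xs] by (simp del: list_encode.simps)
  \<comment> \<open>Below the quantifier the variable is \<open>Suc j\<close>; the numeral is
    closed, so shifting leaves it alone.\<close>
  moreover have "representable L T (\<lambda>m. code (subst (under_binder (\<sigma> m)) A)) (\<lambda>m. code_tm (num m))"
    by (rule All.IH[of "Suc j"]) (use All.prems in auto)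
  ultimately show ?case using representable_comp by (simp del: list_encode.simps)
qed

text \<open>The numeral of \<open>m\<close> occurs in the instance, so its code can be read off the instance's.\<close>

lemma representable_numeral:
  assumes Sub: "represents_instances L T A Sub" and A: "1 \<in> fv A"
  shows "representable L T (\<lambda>m. m) (\<lambda>m. code_tm (num m))"
proof (rule representable_comp)
  have formula_Sub: "formula L 3 Sub" using Sub by (simp add: represents_instances_def)
  \<comment> \<open>Any fixed first argument would do; the parameter \<open>m\<close> is the
    threshold.\<close>
  let ?F = "app Sub [Zero, Var 0, Var 1]"
  have "represents L T ?F (\<lambda>m. m) (\<lambda>m. code (app A [num 0, num m]))"
    unfolding represents_def
  proof (intro conjI allI impI ballI)
    show "formula L 2 ?F" by (auto intro!: formula_Sub[THEN formula_app])
    fix N :: "tm struc" and m b assume N: "model L T N" and b: "b \<in> carr N"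
    have "prv L T (All (Iff (app Sub [num 0, num m, Var 0])
        (Eq (Var 0) (quote (app A [num 0, num m])))))"
      using Sub unfolding represents_instances_def by blast
    moreover have "range (\<lambda>_ :: nat. numv N 0) \<subseteq> carr N" using numv_carr[OF N] by auto
    ultimately have "holds N (\<lambda>_. numv N 0) (All (Iff (app Sub [num 0, num m, Var 0])
        (Eq (Var 0) (quote (app A [num 0, num m])))))"
      by (rule model_holds[OF N])
    then have "pred N Sub [numv N 0, numv N m, b] \<longleftrightarrow> b = numv N (code (app A [num 0, num m]))"
      using b unfolding holds.simps(5) holds_Iff
      by (simp add: formula_Sub[THEN holds_app] quote_def numv_0)
    then show "pred N ?F [numv N m, b] \<longleftrightarrow> b = numv N (code (app A [num 0, num m]))"
      unfolding pred_def[of N ?F] by (simp add: formula_Sub[THEN holds_app] numv_0)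
  qed
  then show "representable L T (\<lambda>m. m) (\<lambda>m. code (app A [num 0, num m]))"
    by (auto simp: representable_def)
  show "representable L T (\<lambda>m. code (app A [num 0, num m])) (\<lambda>m. code_tm (num m))"
    unfolding app_def by (rule representable_numeral_in_fm[OF A]) simp
qed

text \<open>\<open>fix_fm m C\<close> is equivalent to the instance of \<open>C\<close> at \<open>m\<close>, but its code is easier to obtain.\<close>

definition fix_fm :: "nat \<Rightarrow> fm \<Rightarrow> fm" where
  "fix_fm m C = All (Imp (Eq (Var 0) (num m)) C)"

lemma representable_code_fix_fm:
  assumes num: "representable L T (\<lambda>m. m) (\<lambda>m. code_tm (num m))"
  obtains d where "representable L T (\<lambda>m. m) d" "\<And>C. d (code C) = code (fix_fm (code C) C)"
proof
  \<comment> \<open>With \<open>m\<close> in the place of the code of \<open>C\<close>, the argument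
    occurs twice: once through its numeral and once as it stands.\<close>
  let ?d = "\<lambda>m. list_encode [4, list_encode [3, list_encode [1, code_tm (Var 0), code_tm (num m)], m]]"
  show "representable L T (\<lambda>m. m) ?d"
    unfolding list_encode.simps(2)
    by (intro representable_Cons representable_const num representable_id)
  show "?d (code C) = code (fix_fm (code C) C)" for C
    by (simp only: fix_fm_def code.simps)
qed

section \<open>The diagonal lemma and Loeb's theorem\<close>

text \<open>\<open>C\<close> says of a number that the value of \<open>d\<close> there satisfies
  \<open>B\<close>. Applied to its own code by means of \<open>fix_fm\<close>, it speaks about the
  code of \<open>G\<close>, since \<open>d (code C) = code G\<close>.\<close>

lemma diagonal:
  assumes T: "theory_over L T" and num: "representable L T (\<lambda>m. m) (\<lambda>m. code_tm (num m))"
    and B: "formula L 1 B"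
  shows "\<exists>G. sentence L G \<and> prv L T (Iff G (app B [quote G]))"
proof -
  obtain d where "representable L T (\<lambda>m. m) d" and d: "\<And>C. d (code C) = code (fix_fm (code C) C)"
    using representable_code_fix_fm[OF num] by blast
  then obtain D where D: "represents L T D (\<lambda>m. m) d" by (auto simp: representable_def)
  then have formula_D: "formula L 2 D" by (simp add: represents_def)
  define C where "C = All (Imp (app D [Var 1, Var 0]) (app B [Var 0]))"
  define G where "G = fix_fm (code C) C"
  have C: "formula L 1 C"
    unfolding C_def by (auto intro!: formula_intros formula_D[THEN formula_app] B[THEN formula_app])
  then have "sentence L G"
    unfolding G_def fix_fm_def by (auto intro!: formula_intros formula_Eq)
  moreover have "sentence L (app B [quote G])"
    unfolding quote_def by (auto intro!: B[THEN formula_app])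
  ultimately have Iff: "sentence L (Iff G (app B [quote G]))"
    by (auto intro!: formula_Imp formula_Fls)
  have "holds N \<rho> (Iff G (app B [quote G]))" if N: "model L T N" for N :: "tm struc" and \<rho>
  proof -
    have "holds N \<rho> G \<longleftrightarrow> holds N (case_nat (numv N (code C)) \<rho>) C"
      using numv_carr[OF N] by (simp add: G_def fix_fm_def)
    also have "\<dots> \<longleftrightarrow> (\<forall>b\<in>carr N. pred N D [numv N (code C), b] \<longrightarrow> pred N B [b])"
      by (simp add: C_def formula_D[THEN holds_app] B[THEN holds_app])
    also have "\<dots> \<longleftrightarrow> (\<forall>b\<in>carr N. b = numv N (code G) \<longrightarrow> pred N B [b])"
      using D N d[of C] by (simp add: represents_def G_def)
    also have "\<dots> \<longleftrightarrow> holds N \<rho> (app B [quote G])"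
      using numv_carr[OF N] by (simp add: B[THEN holds_app] quote_def)
    finally show ?thesis unfolding holds_Iff .
  qed
  then have "prv L T (Iff G (app B [quote G]))" by (rule completeness[OF T Iff])
  with \<open>sentence L G\<close> show ?thesis by blast
qed

lemma Loeb:
  assumes T: "theory_over L T" and num: "representable L T (\<lambda>m. m) (\<lambda>m. code_tm (num m))"
    and Prov: "formula L 1 Prov" and HB: "derivability_conditions L T Prov"
    and A: "sentence L A" and reflection: "prv L T (Imp (app Prov [quote A]) A)"
  shows "prv L T A"
proof -
  let ?P = "\<lambda>A. app Prov [quote A]"
  have HB: "\<And>A. sentence L A \<Longrightarrow> prv L T A \<Longrightarrow> prv L T (?P A)"
    "\<And>A B. sentence L A \<Longrightarrow> sentence L B \<Longrightarrow> prv L T (Imp (?P (Imp A B)) (Imp (?P A) (?P B)))"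
    "\<And>A. sentence L A \<Longrightarrow> prv L T (Imp (?P A) (?P (?P A)))"
    using HB unfolding derivability_conditions_def by blast+
  have P: "sentence L (?P A)" for A
    unfolding quote_def by (auto intro!: Prov[THEN formula_app])
  have app_B: "app (Imp Prov A) [quote G] = Imp (?P G) A" for G
    using A by (simp add: app_def subst_sentence)
  \<comment> \<open>The fixed point of this formula is the Loeb sentence, which says of itself that
    its provability implies \<open>A\<close>.\<close>
  have "formula L 1 (Imp Prov A)" by (rule formula_Imp[OF Prov formula_mono[OF A]]) simp
  from diagonal[OF T num this] obtain G where G: "sentence L G" and GA: "prv L T (Iff G (Imp (?P G) A))"
    unfolding app_B by blast
  \<comment> \<open>Propositional steps are taken semantically, where they are immediate, and
    brought back by completeness.\<close>
  have infer: "prv L T B" if "sentence L B"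
    "\<And>N :: tm struc. \<And>\<rho>. \<forall>C. prv L T C \<longrightarrow> holds N \<rho> C \<Longrightarrow> holds N \<rho> B" for B
    using that by (intro completeness[OF T]) (auto simp: model_def)
  have 1: "prv L T (Imp G (Imp (?P G) A))"
  proof (rule infer)
    show "sentence L (Imp G (Imp (?P G) A))" by (intro formula_Imp G A P)
    fix N :: "tm struc" and \<rho> assume *: "\<forall>C. prv L T C \<longrightarrow> holds N \<rho> C"
    show "holds N \<rho> (Imp G (Imp (?P G) A))"
      using *[rule_format, OF GA] unfolding holds_Iff by simp
  qed
  have 2: "prv L T (?P (Imp G (Imp (?P G) A)))"
    by (intro HB(1) 1 formula_Imp G A P)
  have 3: "prv L T (Imp (?P (Imp G (Imp (?P G) A))) (Imp (?P G) (?P (Imp (?P G) A))))"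
    "prv L T (Imp (?P (Imp (?P G) A)) (Imp (?P (?P G)) (?P A)))"
    by (intro HB(2) formula_Imp G A P)+
  \<comment> \<open>Argued inside \<open>T\<close>: if \<open>G\<close> is provable, so is
    \<open>Imp (?P G) A\<close> by 2 and 3, and so is \<open>?P G\<close> by the third derivability
    condition; hence \<open>A\<close> is provable, and reflection yields \<open>A\<close>.\<close>
  have 4: "prv L T (Imp (?P G) A)"
  proof (rule infer)
    show "sentence L (Imp (?P G) A)" by (intro formula_Imp A P)
    fix N :: "tm struc" and \<rho> assume *: "\<forall>C. prv L T C \<longrightarrow> holds N \<rho> C"
    show "holds N \<rho> (Imp (?P G) A)"
      using *[rule_format, OF 2] *[rule_format, OF 3(1)] *[rule_format, OF 3(2)]
        *[rule_format, OF HB(3)[OF G]] *[rule_format, OF reflection] by simp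
  qed
  have 5: "prv L T G"
  proof (rule infer[OF G])
    fix N :: "tm struc" and \<rho> assume *: "\<forall>C. prv L T C \<longrightarrow> holds N \<rho> C"
    show "holds N \<rho> G" using *[rule_format, OF 4] *[rule_format, OF GA] unfolding holds_Iff by blast
  qed
  from prv.MP[OF 4 HB(1)[OF G 5]] show ?thesis .
qed

end

section \<open>The channel with constant output\<close>

text \<open>On the support, adjoining \<open>Y\<close> to an event changes no probability, so the
  quotient under the logarithm is 1; null atoms vanish through the factor before it. Constancy is
  asked on the support only, because for other triples the output at a position may be anything.
  Finite ranges give the sum formula.\<close>

lemma cond_mutual_info_constant:
  assumes fin: "finite (range X)" "finite (range Y)" "finite (range Z)"
    and Y: "\<And>w. w \<in> set_pmf P \<Longrightarrow> Y w = c"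
  shows "cond_mutual_info P X Y Z = 0"
proof -
  interpret information_space "measure_pmf P" 2 by unfold_locales simp
  let ?m = "\<lambda>A. measure (measure_pmf P) A"
  have simple: "simple_function (measure_pmf P) f" if "finite (range f)" for f
    using that by (simp add: simple_function_def)
  have dist: "simple_distributed (measure_pmf P) f (\<lambda>a. ?m (f -` {a}))" if "finite (range f)" for f
    by (rule measure_pmf.simple_distributedI[OF simple[OF that]]) simp_all
  have fin': "finite (range (\<lambda>w. (f w, g w)))" if "finite (range f)" "finite (range g)" for f g
    by (rule finite_subset[OF _ finite_cartesian_product[OF that]]) auto
  have cong: "?m A = ?m B" if "\<And>w. w \<in> set_pmf P \<Longrightarrow> w \<in> A \<longleftrightarrow> w \<in> B" for A B
  proof -
    have "A \<inter> set_pmf P = B \<inter> set_pmf P" using that by blast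
    then show ?thesis by (metis measure_Int_set_pmf)
  qed
  define Pz where "Pz z = ?m (Z -` {z})" for z
  define Pyz where "Pyz a = ?m ((\<lambda>w. (Y w, Z w)) -` {a})" for a
  define Pxz where "Pxz a = ?m ((\<lambda>w. (X w, Z w)) -` {a})" for a
  define Pxyz where "Pxyz a = ?m ((\<lambda>w. (X w, Y w, Z w)) -` {a})" for a
  have "cond_mutual_info P X Y Z = (\<Sum>(x, y, z)\<in>range (\<lambda>w. (X w, Y w, Z w)).
      Pxyz (x, y, z) * log 2 (Pxyz (x, y, z) / (Pxz (x, z) * (Pyz (y, z) / Pz z))))"
    unfolding cond_mutual_info_def
    using conditional_mutual_information_eq[of Z Pz Y Pyz X Pxz Pxyz] fin
    by (simp add: Pz_def[abs_def] Pyz_def[abs_def] Pxz_def[abs_def] Pxyz_def[abs_def] dist fin')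
  also have "\<dots> = 0"
  proof (rule sum.neutral, clarify)
    fix w
    let ?x = "X w" and ?y = "Y w" and ?z = "Z w"
    show "Pxyz (?x, ?y, ?z) * log 2 (Pxyz (?x, ?y, ?z) / (Pxz (?x, ?z) * (Pyz (?y, ?z) / Pz ?z))) = 0"
    proof (cases "Pxyz (?x, ?y, ?z) = 0")
      case False
      have "?y = c"
      proof (rule ccontr)
        assume "?y \<noteq> c"
        then have "Pxyz (?x, ?y, ?z) = ?m {}" unfolding Pxyz_def by (intro cong) (auto simp: Y)
        with False show False by simp
      qed
      then have eq: "Pxyz (?x, ?y, ?z) = Pxz (?x, ?z)" "Pyz (?y, ?z) = Pz ?z"
        unfolding Pxyz_def Pxz_def Pyz_def Pz_def by (auto intro!: cong simp: Y)
      have "Pxz (?x, ?z) \<le> Pz ?z"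
        unfolding Pxz_def Pz_def by (rule measure_pmf.finite_measure_mono) auto
      moreover have "Pxz (?x, ?z) > 0" using False eq by (simp add: Pxz_def zero_less_measure_iff)
      ultimately show ?thesis by (simp add: eq)
    qed simp
  qed
  finally show ?thesis .
qed

text \<open>The last state is carried along because \<open>pmf_kernel_pmf\<close> describes the
  kernel only from genuine states; the length makes the output positions valid.\<close>

lemma joint_law_constant_fsc:
  assumes "(xs, ys, ss) \<in> set_pmf (joint_law constant_fsc p n)"
  shows "length ys = n \<and> last ss = 0 \<and> (\<forall>y\<in>set ys. \<not> y)"
  using assms
proof (induction n arbitrary: xs ys ss)
  case 0
  then obtain s where s: "s \<in> set_pmf (init_pmf constant_fsc)" "ys = []" "ss = [s]" by auto
  then have "init constant_fsc s \<noteq> 0"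
    by (auto simp: set_pmf_iff pmf_init_pmf[OF unifilar_constant_fsc])
  then show ?case using s by (simp add: constant_fsc_def split: if_splits)
next
  case (Suc n)
  from Suc.prems obtain xs' ys' ss' x y s where
    prev: "(xs', ys', ss') \<in> set_pmf (joint_law constant_fsc p n)" and
    step: "(y, s) \<in> set_pmf (kernel_pmf constant_fsc x (last ss'))" and
    eq: "ys = ys' @ [y]" "ss = ss' @ [s]" by auto
  note IH = Suc.IH[OF prev]
  then have "kernel constant_fsc x 0 (y, s) \<noteq> 0"
    using step pmf_kernel_pmf[OF unifilar_constant_fsc, of 0 x "(y, s)"]
    by (simp add: set_pmf_iff) (simp add: constant_fsc_def)
  then show ?case using IH by (simp add: eq constant_fsc_def split: if_splits)
qed

lemma finite_short_lists:
  fixes A :: "bool list set"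
  assumes "\<And>xs. xs \<in> A \<Longrightarrow> length xs \<le> t"
  shows "finite A"
  by (rule finite_subset[OF _ finite_lists_length_le[of UNIV t]]) (use assms in auto)

lemma directed_info_constant_fsc: "directed_info constant_fsc p n = 0"
  unfolding directed_info_def
proof (rule sum.neutral, rule ballI)
  fix t assume t: "t \<in> {1..n}"
  let ?P = "joint_law constant_fsc p n"
  show "cond_mutual_info ?P (\<lambda>(xs, ys, ss). take t xs) (\<lambda>(xs, ys, ss). ys ! (t - 1))
    (\<lambda>(xs, ys, ss). take (t - 1) ys) = 0"
  proof (rule cond_mutual_info_constant[where c = False])
    show "finite (range (\<lambda>(xs, ys, ss). take t xs :: bool list))"
      by (rule finite_short_lists[of _ t]) auto
    show "finite (range (\<lambda>(xs, ys, ss). take (t - 1) ys :: bool list))"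
      by (rule finite_short_lists[of _ "t - 1"]) auto
    show "(case w of (xs, ys, ss) \<Rightarrow> ys ! (t - 1)) = False" if "w \<in> set_pmf ?P" for w
    proof -
      obtain xs ys ss where w: "w = (xs, ys, ss)" by (cases w)
      then have ys: "length ys = n" "\<forall>y\<in>set ys. \<not> y"
        using that joint_law_constant_fsc[of xs ys ss p n] by blast+
      have "ys ! (t - 1) \<in> set ys" using t ys(1) by (intro nth_mem) auto
      with ys(2) have "\<not> ys ! (t - 1)" by blast
      then show ?thesis by (simp add: w)
    qed
  qed (rule finite)
qed

text \<open>Every quotient in the limit superior is 0, including that for \<open>n = 0\<close>,
  where \<open>0 / 0 = 0\<close> in \<open>ereal\<close>.\<close>

lemma fb_capacity_constant_fsc: "fb_capacity constant_fsc = 0"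
  by (simp add: fb_capacity_def max_directed_info_def directed_info_constant_fsc Limsup_const
    flip: zero_ereal_def)

section \<open>Contradiction at a threshold above the capacity\<close>

theorem mainTheorem6:
  fixes L :: lang and M :: expansion and Cap :: fm
  assumes "formula L 2 Cap" and "Cap_semantics M Cap"
  shows "\<not> (\<exists>T Prov Sub.
      theory_over L T \<and> consistent L T \<and> rec_axiomatized T \<and> sound L M T \<and> interprets_Q L T \<and>
      provability_predicate L M T Prov \<and> derivability_conditions L T Prov \<and>
      represents_instances L T Cap Sub \<and> prv L T (uniform_reflection Prov Sub Cap))"
proof
  assume "\<exists>T Prov Sub.
      theory_over L T \<and> consistent L T \<and> rec_axiomatized T \<and> sound L M T \<and> interprets_Q L T \<and>
      provability_predicate L M T Prov \<and> derivability_conditions L T Prov \<and>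
      represents_instances L T Cap Sub \<and> prv L T (uniform_reflection Prov Sub Cap)"
  then obtain T Prov Sub where T: "theory_over L T" and sound: "sound L M T"
    and "interprets_Q L T" and "provability_predicate L M T Prov"
    and HB: "derivability_conditions L T Prov" and Sub: "represents_instances L T Cap Sub"
    and reflection: "prv L T (uniform_reflection Prov Sub Cap)"
    by blast
  then obtain I where I: "interpretation_of_Q L T I" "numerals_agree L T I"
    by (auto simp: interprets_Q_def)
  have Prov: "formula L 1 Prov"
    using \<open>provability_predicate L M T Prov\<close> by (simp add: provability_predicate_def)
  have formula_Sub: "formula L 3 Sub" using Sub by (simp add: represents_instances_def)
  note formula_Cap = \<open>formula L 2 Cap\<close>

  have "constant_fsc \<in> range channel"
    using unifilar_constant_fsc by (simp add: range_channel)
  then obtain e where e: "channel e = constant_fsc" by (metis rangeE)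
  \<comment> \<open>Codes of the thresholds 0 and 1: at capacity 0 the first gives a true instance
    and the second a false one.\<close>
  obtain c0 c1 where c: "nat_to_rat_surj c0 = 0" "nat_to_rat_surj c1 = 1"
    using surj_nat_to_rat_surj by (metis surjD)
  define i where "i = string_code e"
  let ?Cap = "\<lambda>c. app Cap [num i, num c]"
  have "true_in M (?Cap c) \<longleftrightarrow> ereal (real_of_rat (nat_to_rat_surj c)) \<le> 0" for c
    using \<open>Cap_semantics M Cap\<close> e fb_capacity_constant_fsc by (simp add: Cap_semantics_def i_def)
  then have true: "true_in M (?Cap c0)" and false: "\<not> true_in M (?Cap c1)"
    using c by simp_all

  \<comment> \<open>Otherwise the two instances would be the same formula, with two different truth
    values.\<close>
  have "1 \<in> fv Cap"
  proof (rule ccontr)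
    assume "1 \<notin> fv Cap"
    then have 0: "n = 0" if "n \<in> fv Cap" for n
      using that formula_Cap by (cases "n = 1") (auto simp: formula_def subset_iff less_2_cases_iff)
    have "?Cap c0 = ?Cap c1" unfolding app_def by (intro subst_cong) (drule 0, simp)
    then show False using true false by simp
  qed
  note num = representable_numeral[OF I Sub this]

  have Cap: "sentence L (?Cap c1)"
    by (auto intro!: formula_Cap[THEN formula_app])
  \<comment> \<open>With both arguments fixed, \<open>Sub\<close> holds in every model at the
    numeral of the code of this instance. This witness for the existential premise of uniform
    reflection gives the local reflection that Loeb's theorem takes as its premise.\<close>
  have "prv L T (Imp (app Prov [quote (?Cap c1)]) (?Cap c1))"
  proof (rule completeness[OF T])
    show "sentence L (Imp (app Prov [quote (?Cap c1)]) (?Cap c1))"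
      unfolding quote_def by (auto intro!: formula_Imp Prov[THEN formula_app] formula_Cap[THEN formula_app])
    fix N :: "tm struc" and \<rho> :: "nat \<Rightarrow> tm" assume N: "model L T N" and \<rho>: "range \<rho> \<subseteq> carr N"
    have "prv L T (All (Iff (app Sub [num i, num c1, Var 0]) (Eq (Var 0) (quote (?Cap c1)))))"
      using Sub by (simp add: represents_instances_def)
    from model_holds[OF N this \<rho>]
    have sub: "pred N Sub [numv N i, numv N c1, numv N (code (?Cap c1))]"
      using numv_carr[OF N] unfolding holds.simps(5) holds_Iff
      by (simp add: formula_Sub[THEN holds_app] quote_def)
    have refl: "pred N Cap [a, b]"
      if "a \<in> carr N" "b \<in> carr N" "d \<in> carr N" "pred N Sub [a, b, d]" "pred N Prov [d]" for a b d
      using model_holds[OF N reflection \<rho>] that unfolding uniform_reflection_def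
      by (auto simp: formula_Sub[THEN holds_app] Prov[THEN holds_app] formula_Cap[THEN holds_app] numeral_2_eq_2)
    show "holds N \<rho> (Imp (app Prov [quote (?Cap c1)]) (?Cap c1))"
      using refl[OF _ _ _ sub] numv_carr[OF N]
      by (simp add: Prov[THEN holds_app] formula_Cap[THEN holds_app] quote_def)
  qed
  with T num Prov HB Cap have "prv L T (?Cap c1)" by (rule Loeb[OF I])
  then show False using sound Cap false by (simp add: sound_def)
qed

end
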